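(* (i) For $0<\Delta\le 1$ and $w,z\in\mathbb{C}$, \[ K_{\mathrm{SO(odd)},\pi\Delta}(w,z) = \frac{\sin\pi\Delta(z-\overline{w})}{\pi(z-\overline{w})} - \frac{1}{2 + \Delta} \left(\frac{\sin\pi\Delta z}{\pi z}\right) \left( \frac{\sin\pi\Delta \overline{w} }{\pi \overline{w}}\right). \] (ii) For any $\Delta>0$ and $w,z\in\mathbb{C}$, \[ K_{\mathrm{SO(odd)},\pi\Delta}(w,z) = K_{\mathrm{Sp},\pi\Delta}(w,z) - \frac{K_{\mathrm{Sp},\pi\Delta}(w,0)}{1 + K_{\mathrm{Sp},\pi\Delta}(0,0)}K_{\mathrm{Sp},\pi\Delta}(0,z). \]
   Context: $W_{\mathrm{Sp}}(x)=1-\frac{\sin 2\pi x}{2\pi x}$ and $W_{\mathrm{SO(odd)}}(x)=1-\frac{\sin 2\pi x}{2\pi x}+\boldsymbol{\delta}_0(x)$, with $\boldsymbol{\delta}_0$ the Dirac delta at $0$. For $G\in\{\mathrm{Sp},\mathrm{SO(odd)}\}$ and $\Delta>0$, $\mathcal{H}_{G,\pi\Delta}$ is the Hilbert space of entire functions $F$ of exponential type at most $\pi\Delta$ with $\int_{\mathbb{R}}|F|^2W_G<\infty$ and inner product $\langle F,H\rangle=\int F\overline{H}W_G$ (for $\mathrm{SO(odd)}$ this equals $\int F\overline{H}(1-\frac{\sin2\pi x}{2\pi x})dx+F(0)\overline{H(0)}$). Its reproducing kernel $K_{G,\pi\Delta}$ is the unique function on $\mathbb{C}\times\mathbb{C}$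 with $K_{G,\pi\Delta}(w,\cdot)$ in the space and $F(w)=\langle F,K_{G,\pi\Delta}(w,\cdot)\rangle$ for all $F$ and $w$. Removable singularities are interpreted by continuity. *)

theory Defs
  imports "HOL-Analysis.Analysis"
begin

datatype symgroup = Sp | SOodd

definition wSp :: "real \<Rightarrow> real" where
  "wSp x = (if x = 0 then 0 else 1 - sin (2 * pi * x) / (2 * pi * x))"

definition exp_type_le :: "real \<Rightarrow> (complex \<Rightarrow> complex) \<Rightarrow> bool" where
  "exp_type_le \<tau> F \<longleftrightarrow> F holomorphic_on UNIV \<and>
     (\<forall>\<epsilon>>0. \<exists>C. \<forall>z. norm (F z) \<le> C * exp ((\<tau> + \<epsilon>) * norm z))"

text \<open>The space H_{G, pi Delta} (as a set of functions). The Dirac mass for SO(odd)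
  only adds the finite term |F(0)|^2, so the carrier is the same for both G.\<close>
definition HS :: "symgroup \<Rightarrow> real \<Rightarrow> (complex \<Rightarrow> complex) set" where
  "HS G \<Delta> = {F. exp_type_le (pi * \<Delta>) F \<and>
     integrable lborel (\<lambda>x::real. (norm (F (of_real x)))\<^sup>2 * wSp x)}"

definition HS_inner :: "symgroup \<Rightarrow> (complex \<Rightarrow> complex) \<Rightarrow> (complex \<Rightarrow> complex) \<Rightarrow> complex" where
  "HS_inner G F H =
     (LINT x|lborel. F (of_real x) * cnj (H (of_real x)) * of_real (wSp x))
     + (if G = SOodd then F 0 * cnj (H 0) else 0)"

definition is_rk :: "symgroup \<Rightarrow> real \<Rightarrow> (complex \<Rightarrow> complex \<Rightarrow> complex) \<Rightarrow> bool" where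
  "is_rk G \<Delta> K \<longleftrightarrow> (\<forall>w. K w \<in> HS G \<Delta>) \<and>
     (\<forall>F\<in>HS G \<Delta>. \<forall>w. F w = HS_inner G F (K w))"

definition rkernel :: "symgroup \<Rightarrow> real \<Rightarrow> complex \<Rightarrow> complex \<Rightarrow> complex" where
  "rkernel G \<Delta> = (THE K. is_rk G \<Delta> K)"

text \<open>sin(pi Delta u)/(pi u), extended by continuity (value Delta) at u = 0.\<close>
definition csinc :: "real \<Rightarrow> complex \<Rightarrow> complex" where
  "csinc \<Delta> u = (if u = 0 then of_real \<Delta> else sin (of_real (pi * \<Delta>) * u) / (of_real pi * u))"

end

theory Submission
  imports Defs "HOL-Complex_Analysis.Complex_Analysis" "HOL-Probability.Sinc_Integral"
    "HOL-Real_Asymp.Real_Asymp"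
begin

text \<open>
  Since the weight is bounded, and bounded below away from the origin, both spaces coincide as sets
  with the Paley--Wiener space, whose kernel is \<open>csinc \<Delta> (z - cnj w)\<close>. The latter is derived without Fourier
  analysis: by Phragmen--Lindelof a function \<open>F\<close> of type \<open>\<tau>\<close> bounded on the real line is
  \<open>O(exp (\<sigma> |Im z|))\<close> for each \<open>\<sigma> > \<tau>\<close>, so the integrals of
  \<open>(F(z) - F(w)) / (z - w) * exp (\<plusminus> \<i> s (z - w))\<close> with \<open>s > \<sigma>\<close> along the real line vanish by shifting
  the contour, and what remains is the Dirichlet integral. Applied to \<open>F(z) * cnj (H (cnj z))\<close>,
  which has type at most \<open>2 * pi\<close> when \<open>\<Delta> \<le> 1\<close>, the same formula turns the weighted inner product
  into the unweighted one minus \<open>F(0) * cnj (H(0)) / 2\<close>, which gives (i). For (ii), evaluations are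
  bounded in the weighted norm, a minimal-norm argument yields the symplectic kernel, and the Dirac
  mass is a rank-one perturbation of the inner product.
\<close>

section \<open>Phragmen--Lindelof bounds for functions of exponential type\<close>

text \<open>Since \<open>rkernel\<close> is a definite description, both claims include existence
  and uniqueness. For \<Delta> above 1 the symplectic kernel is not given by a formula here, and a
  minimiser takes the place of a Hilbert space projection. The obstacle is that the weight vanishes
  at 0, which rules out a pointwise comparison of the two norms; bounded evaluation in the
  unweighted norm keeps mass from concentrating there.

  Membership gives square integrability, while Phragmen-Lindelof asks for boundedness on the real
  line. The bridge is the integrable entire function \<open>F z * reflect F z\<close> and its
  primitive.

  The weight is \<open>1 - csinc 2 / 2\<close>, and \<open>csinc 2\<close> is the Paley-Wiener
  kernel at 0 for type \<open>2 * pi\<close>: hence both the condition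
  \<open>\<Delta> \<le> 1\<close> and the coefficient -1/2. With the Dirac mass the product becomes
  the unweighted one plus a mass 1/2 at 0. A mass m turns a kernel k into
  \<open>k w z - m * k w 0 * k 0 z / (1 + m * k 0 0)\<close>; \<open>m = 1/2\<close> and
  \<open>k 0 0 = \<Delta>\<close> give the factor \<open>1 / (2 + \<Delta>)\<close>.\<close>

lemma Re_cube_ge_norm_cube:
  fixes s :: complex
  assumes s: "0 \<le> Re s" and sq: "\<bar>Im (s\<^sup>2)\<bar> \<le> Re (s\<^sup>2)"
  shows "norm s ^ 3 / 8 \<le> Re (s ^ 3)"
proof -
  define a b where "a = Re s" and "b = \<bar>Im s\<bar>"
  have ab: "2 * a * b \<le> a\<^sup>2 - b\<^sup>2" "0 \<le> a" "0 \<le> b"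
    using sq s by (auto simp: a_def b_def power2_eq_square abs_mult ac_simps)
  \<comment> \<open>The hypotheses confine the argument of \<open>s\<close> to at most pi/8 in
    absolute value, and tan (pi/8) = sqrt 2 - 1 is below 1/2. Cubing leaves an argument of at most 3
    pi/8, whose cosine exceeds 1/8.\<close>
  have b: "2 * b \<le> a"
  proof (rule ccontr)
    assume "\<not> 2 * b \<le> a"
    then have "a < 2 * b" by simp
    then have "a * a \<le> 2 * a * b" using ab mult_left_mono[of a "2*b" a] by (simp add: ac_simps)
    moreover have "0 < b * b" using \<open>a < 2 * b\<close> ab by simp
    ultimately show False using ab by (simp add: power2_eq_square)
  qed
  have b2: "4 * b\<^sup>2 \<le> a\<^sup>2"
    using power_mono[OF b, of 2] ab by (simp add: power_mult_distrib)
  have n2: "norm s ^ 2 \<le> 5/4 * a\<^sup>2"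
    using b2 by (simp add: cmod_power2 a_def b_def)
  have "norm s ^ 3 = norm s ^ 2 * norm s" by (simp add: power2_eq_square power3_eq_cube)
  also have "\<dots> \<le> 5/4 * a\<^sup>2 * (norm s)" using n2 by (intro mult_right_mono) auto
  also have "norm s \<le> 3/2 * a"
  proof (rule power2_le_imp_le)
    show "norm s ^ 2 \<le> (3/2 * a)\<^sup>2"
    proof -
      have "(3/2 * a)\<^sup>2 = 5/4 * a\<^sup>2 + a\<^sup>2" by (simp add: power2_eq_square)
      then show ?thesis using n2 zero_le_power2[of a] by linarith
    qed
  qed (use ab in auto)
  then have "5/4 * a\<^sup>2 * (norm s) \<le> 5/4 * a\<^sup>2 * (3/2 * a)" by (intro mult_left_mono) auto
  also have "\<dots> \<le> 2 * a ^ 3" using ab by (simp add: power2_eq_square power3_eq_cube)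
  finally have 1: "norm s ^ 3 \<le> 2 * a ^ 3" .
  have "Re (s ^ 3) = a * (a\<^sup>2 - 3 * b\<^sup>2)"
    by (simp add: power3_eq_cube power2_eq_square a_def b_def algebra_simps)
  also have "\<dots> \<ge> a * (a\<^sup>2 / 4)"
    using b2 ab by (intro mult_left_mono) auto
  finally have "a ^ 3 / 4 \<le> Re (s ^ 3)" by (simp add: power2_eq_square power3_eq_cube)
  with 1 show ?thesis by simp
qed

text \<open>A sector of opening pi/2 tolerates growth of any order below 2. Here the order is 1, and
  the auxiliary factor of order 3/2 lies strictly between the two.\<close>

lemma phragmen_lindelof_quadrant:
  fixes f :: "complex \<Rightarrow> complex"
  assumes holf: "f holomorphic_on UNIV" and M: "0 < M"
    and growth: "\<And>z. norm (f z) \<le> A * exp (B * norm z)"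
    and real: "\<And>x::real. 0 \<le> x \<Longrightarrow> norm (f (of_real x)) \<le> M"
    and imag: "\<And>y::real. 0 \<le> y \<Longrightarrow> norm (f (\<i> * of_real y)) \<le> M"
    and z: "0 \<le> Re z" "0 \<le> Im z"
  shows "norm (f z) \<le> M"
proof -
  \<comment> \<open>\<open>s z ^ 3\<close> is a branch of the power 3/2 whose argument stays below \<open>3 pi / 8\<close> on the quadrant, so
    \<open>exp (- e * s z ^ 3)\<close> beats exponential growth there.\<close>
  define s where "s = (\<lambda>z. csqrt (1 + (1 - \<i>) * z))"
  have s3: "norm z powr (3/2) / 8 \<le> Re (s z ^ 3)" if "0 \<le> Re z" "0 \<le> Im z" for z
  proof -
    have "norm z \<le> Re z + Im z"
      using cmod_le[of z] that by simp
    also have "\<dots> \<le> Re (1 + (1 - \<i>) * z)" by simp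
    also have "\<dots> \<le> norm (1 + (1 - \<i>) * z)" by (rule complex_Re_le_cmod)
    also have "\<dots> = norm (s z) ^ 2" unfolding s_def norm_power[symmetric] by simp
    finally have "norm z powr (3/2) \<le> (norm (s z) ^ 2) powr (3/2)"
      by (intro powr_mono2) auto
    also have "\<dots> = norm (s z) ^ 3"
      using powr_powr[of "norm (s z)" 2 "3/2"] by simp
    also have "norm (s z) ^ 3 / 8 \<le> Re (s z ^ 3)"
    proof (rule Re_cube_ge_norm_cube)
      show "0 \<le> Re (s z)" unfolding s_def using csqrt_principal[of "1 + (1 - \<i>) * z"] by auto
      show "\<bar>Im ((s z)\<^sup>2)\<bar> \<le> Re ((s z)\<^sup>2)" using that by (simp add: s_def)
    qed
    finally show ?thesis by simp
  qed
  have bound: "norm (f z * exp (- (of_real e * s z ^ 3))) \<le> M" if e: "0 < e" for e :: real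
  proof -
    define g where "g = (\<lambda>z. f z * exp (- (of_real e * s z ^ 3)))"
    have ng: "norm (g u) \<le> norm (f u) * exp (- (e * norm u powr (3/2) / 8))"
      if "0 \<le> Re u" "0 \<le> Im u" for u
    proof -
      have "norm (g u) = norm (f u) * exp (- (e * Re (s u ^ 3)))"
        by (simp add: g_def norm_mult)
      also have "\<dots> \<le> norm (f u) * exp (- (e * (norm u powr (3/2) / 8)))"
        using s3[OF that] e by (intro mult_left_mono) auto
      finally show ?thesis by simp
    qed
    define A' B' where "A' = \<bar>A\<bar> + 1" and "B' = \<bar>B\<bar> + 1"
    have pos: "A' > 0" "B' > 0" by (auto simp: A'_def B'_def)
    have "((\<lambda>r. A' * exp (B' * r) * exp (- (e * r powr (3/2) / 8))) \<longlongrightarrow> 0) at_top"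
      using pos e by real_asymp
    then have "\<forall>\<^sub>F r in at_top. A' * exp (B' * r) * exp (- (e * r powr (3/2) / 8)) < M"
      using M by (simp add: order_tendsto_iff)
    then obtain R0 where R0: "\<And>r. r \<ge> R0 \<Longrightarrow> A' * exp (B' * r) * exp (- (e * r powr (3/2) / 8)) < M"
      by (auto simp: eventually_at_top_linorder)
    define R where "R = Max {R0, Re z + 1, Im z + 1}"
    have R: "R \<ge> R0" "R > Re z" "R > Im z" by (auto simp: R_def max_def)
    \<comment> \<open>The factor \<open>1 - \<i>\<close> turns the quadrant into a sector symmetric
      about the positive real axis; the summand 1 moves its corner off the branch point of the
      square root. Thus \<open>g\<close> is holomorphic on a neighbourhood of the closed
      square.\<close>
    define S where "S = {u. 0 < Re (1 + (1 - \<i>) * u)}"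
    have S: "open S" unfolding S_def by (intro open_Collect_less continuous_intros)
    have gS: "g holomorphic_on S"
      unfolding g_def s_def
      by (intro holomorphic_intros holomorphic_on_subset[OF holf])
         (auto simp: S_def complex_nonpos_Reals_iff)
    have sub: "cbox 0 (Complex R R) \<subseteq> S"
      by (auto simp: S_def in_cbox_complex_iff)
    have far: "norm (g u) \<le> M" if u: "0 \<le> Re u" "0 \<le> Im u" "R \<le> norm u" for u
    proof -
      have "norm (g u) \<le> norm (f u) * exp (- (e * norm u powr (3/2) / 8))"
        by (rule ng) (use u in auto)
      also have "norm (f u) \<le> A' * exp (B' * norm u)"
        using growth[of u]
        by (rule order_trans, intro mult_mono) (auto simp: A'_def B'_def intro!: mult_right_mono)
      then have "norm (f u) * exp (- (e * norm u powr (3/2) / 8)) \<le>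
          A' * exp (B' * norm u) * exp (- (e * norm u powr (3/2) / 8))"
        by (intro mult_right_mono) auto
      also have "\<dots> < M" using u R by (intro R0) auto
      finally show ?thesis by simp
    qed
    have near: "norm (g u) \<le> M" if "norm (f u) \<le> M" "0 \<le> Re u" "0 \<le> Im u" for u
    proof -
      have "norm (f u) * exp (- (e * norm u powr (3/2) / 8)) \<le> M * 1"
        using that e M by (intro mult_mono) auto
      with ng[OF that(2,3)] show ?thesis by simp
    qed
    have "norm (g z) \<le> M"
    proof (rule maximum_modulus_frontier[where f = g and \<xi> = z and S = "cbox 0 (Complex R R)"])
      show "g holomorphic_on interior (cbox 0 (Complex R R))"
        using gS sub interior_subset by (blast intro: holomorphic_on_subset)
      show "continuous_on (closure (cbox 0 (Complex R R))) g"
        using holomorphic_on_imp_continuous_on[OF gS] sub by (auto intro: continuous_on_subset)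
      show "z \<in> cbox 0 (Complex R R)" using z R by (simp add: in_cbox_complex_iff)
      fix u assume "u \<in> frontier (cbox 0 (Complex R R))"
      then have u: "0 \<le> Re u" "Re u \<le> R" "0 \<le> Im u" "Im u \<le> R"
        and u': "Re u = 0 \<or> Im u = 0 \<or> Re u = R \<or> Im u = R"
        by (auto simp: frontier_cbox in_cbox_complex_iff in_box_complex_iff)
      consider "Re u = 0" | "Im u = 0" | "Re u = R \<or> Im u = R" using u' by blast
      then show "norm (g u) \<le> M"
      proof cases
        case 1
        then have "u = \<i> * of_real (Im u)" by (simp add: complex_eq_iff)
        then show ?thesis using imag[of "Im u"] near u by metis
      next
        case 2
        then have "u = of_real (Re u)" by (simp add: complex_eq_iff)
        then show ?thesis using real[of "Re u"] near u by metis
      next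
        case 3
        then have "R \<le> norm u" using abs_Re_le_cmod[of u] abs_Im_le_cmod[of u] by auto
        with far u show ?thesis by blast
      qed
    qed auto
    then show ?thesis by (simp add: g_def)
  qed
  have "((\<lambda>e::real. norm (f z * exp (- (of_real e * s z ^ 3)))) \<longlongrightarrow> norm (f z * exp (- (of_real 0 * s z ^ 3)))) (at_right 0)"
    by (intro tendsto_intros)
  then have "((\<lambda>e::real. norm (f z * exp (- (of_real e * s z ^ 3)))) \<longlongrightarrow> norm (f z)) (at_right 0)"
    by simp
  then show ?thesis
    by (rule tendsto_upperbound) (auto simp: eventually_at_right_less bound intro!: eventually_at_rightI[of 0 1])
qed

text \<open>The Schwarz reflection. On the real line it is the conjugate of \<open>F\<close>, so
  products such as \<open>F * cnj H\<close>, which occur under the integrals, extend to entire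
  functions.\<close>

definition reflect :: "(complex \<Rightarrow> complex) \<Rightarrow> complex \<Rightarrow> complex" where
  "reflect F z = cnj (F (cnj z))"

lemma exp_type_le_holomorphic: "exp_type_le \<tau> F \<Longrightarrow> F holomorphic_on UNIV"
  by (simp add: exp_type_le_def)

lemma exp_type_le_bound:
  assumes "exp_type_le \<tau> F" "\<tau> < \<sigma>"
  obtains C where "0 < C" "\<And>z. norm (F z) \<le> C * exp (\<sigma> * norm z)"
proof -
  have "\<exists>C. \<forall>z. norm (F z) \<le> C * exp ((\<tau> + (\<sigma> - \<tau>)) * norm z)"
    using assms unfolding exp_type_le_def by (metis diff_gt_0_iff_gt)
  then obtain C where C: "\<And>z. norm (F z) \<le> C * exp (\<sigma> * norm z)" by auto
  show ?thesis
  proof (rule that[of "\<bar>C\<bar> + 1"])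
    fix z show "norm (F z) \<le> (\<bar>C\<bar> + 1) * exp (\<sigma> * norm z)"
      by (rule order_trans[OF C]) (auto intro: mult_right_mono)
  qed auto
qed

lemma exp_type_leI:
  assumes "F holomorphic_on UNIV"
    and "\<And>\<sigma>. \<tau> < \<sigma> \<Longrightarrow> \<exists>C. \<forall>z. norm (F z) \<le> C * exp (\<sigma> * norm z)"
  shows "exp_type_le \<tau> F"
  using assms unfolding exp_type_le_def by auto

lemma holomorphic_reflect:
  assumes "F holomorphic_on UNIV" shows "reflect F holomorphic_on UNIV"
proof -
  have "(cnj \<circ> F \<circ> cnj) holomorphic_on UNIV"
    by (rule holomorphic_on_compose_cnj_cnj) (use assms in \<open>auto\<close>)
  then show ?thesis by (simp add: o_def reflect_def[abs_def])
qed

lemma exp_type_le_reflect: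
  assumes "exp_type_le \<tau> F" shows "exp_type_le \<tau> (reflect F)"
proof (rule exp_type_leI)
  show "reflect F holomorphic_on UNIV"
    using assms by (intro holomorphic_reflect exp_type_le_holomorphic)
  fix \<sigma> assume "\<tau> < \<sigma>"
  from exp_type_le_bound[OF assms this] obtain C where "\<And>z. norm (F z) \<le> C * exp (\<sigma> * norm z)"
    by metis
  then show "\<exists>C. \<forall>z. norm (reflect F z) \<le> C * exp (\<sigma> * norm z)"
    by (intro exI[of _ C]) (auto simp: reflect_def, metis complex_mod_cnj)
qed

lemma exp_type_le_uminus:
  assumes "exp_type_le \<tau> F" shows "exp_type_le \<tau> (\<lambda>z. F (- z))"
proof (rule exp_type_leI)
  show "(\<lambda>z. F (- z)) holomorphic_on UNIV"
    using exp_type_le_holomorphic[OF assms]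
    by (intro holomorphic_on_compose_gen[of uminus _ F UNIV, unfolded o_def]) (auto intro!: holomorphic_intros)
  fix \<sigma> assume "\<tau> < \<sigma>"
  from exp_type_le_bound[OF assms this] obtain C where "\<And>z. norm (F z) \<le> C * exp (\<sigma> * norm z)"
    by metis
  then show "\<exists>C. \<forall>z. norm (F (- z)) \<le> C * exp (\<sigma> * norm z)"
    by (intro exI[of _ C]) (auto, metis norm_minus_cancel)
qed

text \<open>Multiplication by \<open>exp (\<i> * of_real \<sigma> * z)\<close> leaves the modulus on
  the real axis unchanged and cancels the growth along the positive imaginary axis, so both sides of
  the quadrant carry a bound.\<close>

lemma exp_type_le_bound_quadrant:
  assumes F: "exp_type_le \<tau> F" and \<sigma>: "\<tau> < \<sigma>"
    and M: "\<And>x::real. norm (F (of_real x)) \<le> M"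
  obtains C where "0 < C" "\<And>z. 0 \<le> Re z \<Longrightarrow> 0 \<le> Im z \<Longrightarrow> norm (F z) \<le> C * exp (\<sigma> * \<bar>Im z\<bar>)"
proof -
  from exp_type_le_bound[OF F \<sigma>] obtain C where C: "0 < C" "\<And>z. norm (F z) \<le> C * exp (\<sigma> * norm z)" by metis
  define f where "f = (\<lambda>z. F z * exp (\<i> * of_real \<sigma> * z))"
  have nf: "norm (f z) = norm (F z) * exp (- (\<sigma> * Im z))" for z
    by (simp add: f_def norm_mult)
  have f: "norm (f z) \<le> max C M" if "0 \<le> Re z" "0 \<le> Im z" for z
  proof (rule phragmen_lindelof_quadrant[OF _ _ _ _ _ that])
    show "f holomorphic_on UNIV"
      unfolding f_def by (intro holomorphic_intros exp_type_le_holomorphic[OF F])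
    show "0 < max C M" using C by simp
    show "norm (f z) \<le> C * exp ((\<bar>\<sigma>\<bar> + \<bar>\<sigma>\<bar>) * norm z)" for z
    proof -
      have "norm (f z) \<le> C * exp (\<sigma> * norm z) * exp (\<bar>\<sigma>\<bar> * norm z)"
        unfolding nf
      proof (intro mult_mono C)
        have "- (\<sigma> * Im z) \<le> \<bar>\<sigma> * Im z\<bar>" by simp
        also have "\<dots> \<le> \<bar>\<sigma>\<bar> * norm z"
          unfolding abs_mult by (intro mult_left_mono abs_Im_le_cmod) auto
        finally show "exp (- (\<sigma> * Im z)) \<le> exp (\<bar>\<sigma>\<bar> * norm z)" by simp
      qed (use C in auto)
      also have "\<dots> \<le> C * exp (\<bar>\<sigma>\<bar> * norm z) * exp (\<bar>\<sigma>\<bar> * norm z)"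
        using C by (intro mult_right_mono mult_left_mono) (auto intro: mult_right_mono)
      also have "\<dots> = C * exp ((\<bar>\<sigma>\<bar> + \<bar>\<sigma>\<bar>) * norm z)"
        unfolding distrib_right exp_add by simp
      finally show ?thesis .
    qed
    show "norm (f (of_real x)) \<le> max C M" for x
      using M[of x] by (simp add: nf)
    show "norm (f (\<i> * of_real y)) \<le> max C M" if "0 \<le> y" for y
    proof -
      have "norm (f (\<i> * of_real y)) \<le> C * exp (\<sigma> * y) * exp (- (\<sigma> * y))"
        using C(2)[of "\<i> * of_real y"] that C(1) unfolding nf by (intro mult_mono) (auto simp: norm_mult)
      then show ?thesis by (simp add: mult.assoc flip: exp_add)
    qed
  qed
  show ?thesis
  proof (rule that[of "max C M"])
    fix z :: complex assume z: "0 \<le> Re z" "0 \<le> Im z"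
    show "norm (F z) \<le> max C M * exp (\<sigma> * \<bar>Im z\<bar>)"
      using f[OF z] z by (simp add: nf exp_minus field_simps)
  qed (use C in auto)
qed

text \<open>Negation and conjugation carry the other three quadrants to the first and preserve both
  the type and the bound on the real line.\<close>

lemma exp_type_le_strip_bound:
  assumes F: "exp_type_le \<tau> F" and \<sigma>: "\<tau> < \<sigma>"
    and M: "\<And>x::real. norm (F (of_real x)) \<le> M"
  obtains C where "0 < C" "\<And>z. norm (F z) \<le> C * exp (\<sigma> * \<bar>Im z\<bar>)"
proof -
  note q = exp_type_le_bound_quadrant[OF _ \<sigma>, of _ M]
  obtain C1 where C1: "0 < C1" "\<And>z. 0 \<le> Re z \<Longrightarrow> 0 \<le> Im z \<Longrightarrow> norm (F z) \<le> C1 * exp (\<sigma> * \<bar>Im z\<bar>)"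
    using q[OF F M] by blast
  obtain C2 where C2: "0 < C2" "\<And>z. 0 \<le> Re z \<Longrightarrow> 0 \<le> Im z \<Longrightarrow> norm (F (- z)) \<le> C2 * exp (\<sigma> * \<bar>Im z\<bar>)"
    using q[OF exp_type_le_uminus[OF F]] M[of "- _"] by auto
  obtain C3 where C3: "0 < C3" "\<And>z. 0 \<le> Re z \<Longrightarrow> 0 \<le> Im z \<Longrightarrow> norm (reflect F z) \<le> C3 * exp (\<sigma> * \<bar>Im z\<bar>)"
    using q[OF exp_type_le_reflect[OF F]] M by (auto simp: reflect_def)
  obtain C4 where C4: "0 < C4" "\<And>z. 0 \<le> Re z \<Longrightarrow> 0 \<le> Im z \<Longrightarrow> norm (reflect F (- z)) \<le> C4 * exp (\<sigma> * \<bar>Im z\<bar>)"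
    using q[OF exp_type_le_uminus[OF exp_type_le_reflect[OF F]]] M[of "- _"] by (auto simp: reflect_def)
  show ?thesis
  proof (rule that[of "C1 + C2 + C3 + C4"])
    fix z
    consider "0 \<le> Re z" "0 \<le> Im z" | "0 \<le> Re (- z)" "0 \<le> Im (- z)"
      | "0 \<le> Re (cnj z)" "0 \<le> Im (cnj z)" | "0 \<le> Re (- cnj z)" "0 \<le> Im (- cnj z)"
      by fastforce
    then have "\<exists>C\<in>{C1,C2,C3,C4}. norm (F z) \<le> C * exp (\<sigma> * \<bar>Im z\<bar>)"
    proof cases
      case 1 then show ?thesis using C1(2)[of z] by auto
    next
      case 2 then show ?thesis using C2(2)[of "- z"] by auto
    next
      case 3 then show ?thesis using C3(2)[of "cnj z"] by (auto simp: reflect_def)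
    next
      case 4 then show ?thesis using C4(2)[of "- cnj z"] by (auto simp: reflect_def)
    qed
    then obtain C where "C \<in> {C1,C2,C3,C4}" "norm (F z) \<le> C * exp (\<sigma> * \<bar>Im z\<bar>)" by blast
    moreover have "C * exp (\<sigma> * \<bar>Im z\<bar>) \<le> (C1 + C2 + C3 + C4) * exp (\<sigma> * \<bar>Im z\<bar>)"
      using \<open>C \<in> _\<close> C1(1) C2(1) C3(1) C4(1) by (intro mult_right_mono) auto
    ultimately show "norm (F z) \<le> (C1 + C2 + C3 + C4) * exp (\<sigma> * \<bar>Im z\<bar>)" by linarith
  qed (use C1 C2 C3 C4 in auto)
qed

section \<open>Primitives, and boundedness of integrable functions on the real line\<close>

lemma entire_primitive:
  fixes f :: "complex \<Rightarrow> complex"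
  assumes "f holomorphic_on UNIV"
  obtains g where "\<And>z. (g has_field_derivative f z) (at z)"
  using holomorphic_convex_primitive'[of UNIV f] assms by auto

lemma has_vector_derivative_horizontal:
  assumes "\<And>z. (g has_field_derivative f z) (at z)"
  shows "((\<lambda>x::real. g (of_real x + c)) has_vector_derivative f (of_real x + c)) (at x within S)"
proof -
  have "((\<lambda>x::real. of_real x + c) has_vector_derivative 1) (at x within S)"
    by (auto intro!: derivative_eq_intros)
  from field_vector_diff_chain_within[OF this, of g "f (of_real x + c)"]
  show ?thesis using has_field_derivative_at_within[OF assms] by (simp add: o_def)
qed

lemma has_vector_derivative_vertical:
  assumes "\<And>z. (g has_field_derivative f z) (at z)"
  shows "((\<lambda>y::real. g (c + \<i> * of_real y)) has_vector_derivative \<i> * f (c + \<i> * of_real y)) (at y within S)"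
proof -
  have "((\<lambda>y::real. c + \<i> * of_real y) has_vector_derivative \<i> * 1) (at y within S)"
    by (auto intro!: derivative_eq_intros)
  from field_vector_diff_chain_within[OF this, of g "f (c + \<i> * of_real y)"]
  show ?thesis using has_field_derivative_at_within[OF assms] by (simp add: o_def)
qed

lemma integral_Icc_primitive:
  fixes f g :: "complex \<Rightarrow> complex"
  assumes g: "\<And>z. (g has_field_derivative f z) (at z)" and f: "continuous_on UNIV f"
    and "a \<le> b"
  shows "(LINT x|lborel. indicator {a..b} x *\<^sub>R f (of_real x)) = g (of_real b) - g (of_real a)"
proof (rule integral_FTC_atLeastAtMost[OF \<open>a \<le> b\<close>])
  show "((\<lambda>x. g (of_real x)) has_vector_derivative f (of_real x)) (at x within {a..b})" for x
    using has_vector_derivative_horizontal[OF g, of 0] by simp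
  show "continuous_on {a..b} (\<lambda>x. f (of_real x))"
    by (intro continuous_on_compose2[OF f] continuous_intros) auto
qed

text \<open>The mean value estimate on the disc of radius \<open>norm z\<close> loses a factor
  \<open>norm z\<close>; an exponent strictly between the type and \<sigma> leaves room to absorb
  it.\<close>

lemma exp_type_le_primitive:
  assumes F: "exp_type_le \<tau> F" and \<tau>: "0 \<le> \<tau>" and g: "\<And>z. (g has_field_derivative F z) (at z)"
    and g0: "g 0 = 0"
  shows "exp_type_le \<tau> g"
proof (rule exp_type_leI)
  show "g holomorphic_on UNIV"
    using g by (auto simp: holomorphic_on_def field_differentiable_def)
  fix \<sigma> assume \<sigma>: "\<tau> < \<sigma>"
  define \<rho> where "\<rho> = (\<tau> + \<sigma>) / 2"
  have \<rho>: "\<tau> < \<rho>" "\<rho> < \<sigma>" "0 \<le> \<rho>" using \<sigma> \<tau> by (auto simp: \<rho>_def)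
  obtain C where C: "0 < C" "\<And>z. norm (F z) \<le> C * exp (\<rho> * norm z)"
    using exp_type_le_bound[OF F \<rho>(1)] by blast
  have "norm (g z) \<le> C / (\<sigma> - \<rho>) * exp (\<sigma> * norm z)" for z
  proof -
    have "norm (g z - g 0) \<le> C * exp (\<rho> * norm z) * norm (z - 0)"
    proof (rule field_differentiable_bound[of "cball 0 (norm z)"])
      show "norm (F u) \<le> C * exp (\<rho> * norm z)" if "u \<in> cball 0 (norm z)" for u
        using C(1) \<rho> that
        by (intro order_trans[OF C(2)[of u]]) (auto intro: mult_left_mono)
    qed (use g in \<open>auto intro: has_field_derivative_at_within\<close>)
    also have "norm (z - 0) \<le> exp ((\<sigma> - \<rho>) * norm z) / (\<sigma> - \<rho>)"
    proof -
      have "(\<sigma> - \<rho>) * norm z \<le> exp ((\<sigma> - \<rho>) * norm z)"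
        using exp_ge_add_one_self[of "(\<sigma> - \<rho>) * norm z"] by linarith
      then show ?thesis using \<rho> by (simp add: field_simps)
    qed
    then have "C * exp (\<rho> * norm z) * norm (z - 0) \<le>
        C * exp (\<rho> * norm z) * (exp ((\<sigma> - \<rho>) * norm z) / (\<sigma> - \<rho>))"
      using C by (intro mult_left_mono) auto
    also have "\<dots> = C / (\<sigma> - \<rho>) * (exp (\<rho> * norm z) * exp ((\<sigma> - \<rho>) * norm z))" by simp
    also have "\<dots> = C / (\<sigma> - \<rho>) * exp (\<sigma> * norm z)"
      unfolding exp_add[symmetric] by (simp add: algebra_simps)
    finally show ?thesis by (simp add: g0)
  qed
  then show "\<exists>C. \<forall>z. norm (g z) \<le> C * exp (\<sigma> * norm z)" by blast
qed

text \<open>The primitive of an integrable function is bounded on the real line, so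
  Phragmen--Lindelof bounds it on a strip, and Cauchy's estimate bounds its derivative.\<close>

lemma exp_type_le_integrable_bounded:
  assumes F: "exp_type_le \<tau> F" and \<tau>: "0 \<le> \<tau>"
    and int: "integrable lborel (\<lambda>x::real. F (of_real x))"
  obtains M where "\<And>x::real. norm (F (of_real x)) \<le> M"
proof -
  note holF = exp_type_le_holomorphic[OF F]
  obtain g0 where g0: "\<And>z. (g0 has_field_derivative F z) (at z)"
    using entire_primitive[OF holF] by blast
  define g where "g = (\<lambda>z. g0 z - g0 0)"
  have g: "(g has_field_derivative F z) (at z)" for z
    unfolding g_def by (auto intro!: derivative_eq_intros g0)
  have [simp]: "g 0 = 0" by (simp add: g_def)
  define N where "N = (LINT x|lborel. norm (F (of_real x)))"
  have diff: "norm (g (of_real b) - g (of_real a)) \<le> N" if "a \<le> b" for a b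
  proof -
    have "norm (g (of_real b) - g (of_real a)) = norm (LINT x|lborel. indicator {a..b} x *\<^sub>R F (of_real x))"
      using integral_Icc_primitive[OF g holomorphic_on_imp_continuous_on[OF holF] that] by simp
    also have "\<dots> \<le> (LINT x|lborel. norm (indicator {a..b} x *\<^sub>R F (of_real x)))"
      by (rule integral_norm_bound)
    also have "\<dots> \<le> N"
      unfolding N_def using int
      by (intro integral_mono integrable_norm integrable_mult_indicator) (auto split: split_indicator)
    finally show ?thesis .
  qed
  have gN: "norm (g (of_real x)) \<le> N" for x
    using diff[of 0 x] diff[of x 0] by (cases "0 \<le> x") auto
  obtain C where C: "0 < C" "\<And>z. norm (g z) \<le> C * exp ((\<tau> + 1) * \<bar>Im z\<bar>)"
    using exp_type_le_strip_bound[OF exp_type_le_primitive[OF F \<tau> g] _ gN, of "\<tau> + 1"] by auto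
  have holg: "g holomorphic_on UNIV"
    using g by (auto simp: holomorphic_on_def field_differentiable_def)
  show ?thesis
  proof (rule that)
    fix x :: real
    \<comment> \<open>The disc of radius 1 about a real point stays where the imaginary part is at
      most 1 in absolute value. The summand 1 in the bound makes it strict, as the open target ball
      demands.\<close>
    have "norm ((deriv ^^ 1) g (of_real x)) \<le> fact 1 * (C * exp (\<tau> + 1) + 1) / 1 ^ 1"
    proof (rule Cauchy_higher_deriv_bound[where y = 0])
      fix u assume "u \<in> ball (complex_of_real x) 1"
      then have "\<bar>Im (u - of_real x)\<bar> \<le> 1"
        using abs_Im_le_cmod[of "u - of_real x"] by (simp add: dist_norm norm_minus_commute)
      then have "C * exp ((\<tau> + 1) * \<bar>Im u\<bar>) \<le> C * exp (\<tau> + 1)"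
        using C \<tau> mult_left_mono[of "\<bar>Im u\<bar>" 1 "\<tau> + 1"] by auto
      then show "g u \<in> ball 0 (C * exp (\<tau> + 1) + 1)" using C(2)[of u] by simp
    qed (auto intro: holomorphic_on_subset[OF holg] continuous_on_subset[OF holomorphic_on_imp_continuous_on[OF holg]])
    then show "norm (F (of_real x)) \<le> C * exp (\<tau> + 1) + 1"
      using DERIV_imp_deriv[OF g] by simp
  qed
qed

lemma exp_type_le_mult:
  assumes F: "exp_type_le \<tau> F" and G: "exp_type_le \<upsilon> G"
  shows "exp_type_le (\<tau> + \<upsilon>) (\<lambda>z. F z * G z)"
proof (rule exp_type_leI)
  show "(\<lambda>z. F z * G z) holomorphic_on UNIV"
    by (intro holomorphic_intros exp_type_le_holomorphic[OF F] exp_type_le_holomorphic[OF G])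
  fix \<sigma> assume \<sigma>: "\<tau> + \<upsilon> < \<sigma>"
  define e where "e = (\<sigma> - \<tau> - \<upsilon>) / 2"
  have e: "e > 0" "\<sigma> = (\<tau> + e) + (\<upsilon> + e)" using \<sigma> by (auto simp: e_def field_simps)
  obtain A where A: "0 < A" "\<And>z. norm (F z) \<le> A * exp ((\<tau> + e) * norm z)"
    using exp_type_le_bound[OF F, of "\<tau> + e"] e by auto
  obtain B where B: "0 < B" "\<And>z. norm (G z) \<le> B * exp ((\<upsilon> + e) * norm z)"
    using exp_type_le_bound[OF G, of "\<upsilon> + e"] e by auto
  have "norm (F z * G z) \<le> (A * B) * exp (\<sigma> * norm z)" for z
  proof -
    have "norm (F z * G z) \<le> (A * exp ((\<tau> + e) * norm z)) * (B * exp ((\<upsilon> + e) * norm z))"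
      unfolding norm_mult using A(1) by (intro mult_mono A(2) B(2)) auto
    also have "\<dots> = (A * B) * exp (\<sigma> * norm z)"
      unfolding e(2) distrib_right exp_add by simp
    finally show ?thesis .
  qed
  then show "\<exists>C. \<forall>z. norm (F z * G z) \<le> C * exp (\<sigma> * norm z)" by blast
qed

text \<open>The squared modulus on the real line is the restriction of the entire function
  \<open>F z * reflect F z\<close>, which has type at most \<open>\<tau> + \<tau>\<close> and is
  integrable, so the integrable case applies to it.\<close>

lemma exp_type_le_L2_bounded:
  assumes F: "exp_type_le \<tau> F" and \<tau>: "0 \<le> \<tau>"
    and int: "integrable lborel (\<lambda>x::real. (norm (F (of_real x)))\<^sup>2)"
  obtains M where "\<And>x::real. norm (F (of_real x)) \<le> M"
proof -
  have eq: "F (of_real x) * reflect F (of_real x) = of_real ((norm (F (of_real x)))\<^sup>2)" for x :: real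
    by (simp only: reflect_def complex_cnj_complex_of_real complex_norm_square)
  have "integrable lborel (\<lambda>x::real. F (of_real x) * reflect F (of_real x))"
    unfolding eq using int by (rule integrable_of_real)
  then obtain M where M: "\<And>x::real. norm (F (of_real x) * reflect F (of_real x)) \<le> M"
    using exp_type_le_integrable_bounded[OF exp_type_le_mult[OF F exp_type_le_reflect[OF F]]] \<tau> by auto
  show ?thesis
  proof (rule that)
    fix x :: real
    have "(norm (F (of_real x)))\<^sup>2 \<le> M" using M[of x] unfolding eq norm_of_real by simp
    then show "norm (F (of_real x)) \<le> sqrt M" by (rule real_le_rsqrt)
  qed
qed

section \<open>The function \<open>csinc\<close>: holomorphy and growth\<close>

text \<open>As the difference quotient of an entire function at 0, with the derivative as value
  there, \<open>csinc\<close> has the shape to which the removable singularity theorem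
  \<open>pole_lemma\<close> applies.\<close>

lemma csinc_alt:
  "csinc d = (\<lambda>z. if z = 0 then deriv (\<lambda>u. sin (of_real (pi * d) * u) / of_real pi) 0
     else (sin (of_real (pi * d) * z) / of_real pi - sin (of_real (pi * d) * 0) / of_real pi) / (z - 0))"
proof -
  have "((\<lambda>u. sin (of_real (pi * d) * u) / of_real pi) has_field_derivative of_real d) (at (0::complex))"
    by (auto intro!: derivative_eq_intros)
  from DERIV_imp_deriv[OF this] show ?thesis by (auto simp: csinc_def fun_eq_iff)
qed

lemma holomorphic_csinc: "csinc d holomorphic_on UNIV"
  unfolding csinc_alt by (rule pole_lemma) (auto intro!: holomorphic_intros)

lemma continuous_csinc: "continuous_on A (csinc d)"
  using holomorphic_on_imp_continuous_on[OF holomorphic_csinc] continuous_on_subset by blast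

lemma csinc_minus [simp]: "csinc d (- u) = csinc d u"
  by (simp add: csinc_def)

lemma cnj_csinc: "cnj (csinc d u) = csinc d (cnj u)"
  by (simp add: csinc_def cnj_sin)

lemma csinc_0 [simp]: "csinc d 0 = of_real d"
  by (simp add: csinc_def)

lemma csinc_mult: "of_real pi * u * csinc d u = sin (of_real (pi * d) * u)"
  by (simp add: csinc_def)

lemma norm_sin_le_exp_Im: "norm (sin z) \<le> exp \<bar>Im z\<bar>" for z :: complex
proof -
  have "norm (sin z) = norm (exp (\<i> * z) - exp (- (\<i> * z))) / 2"
    by (simp add: sin_exp_eq norm_divide norm_mult)
  also have "\<dots> \<le> (norm (exp (\<i> * z)) + norm (exp (- (\<i> * z)))) / 2"
    by (intro divide_right_mono norm_triangle_ineq4) auto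
  also have "\<dots> \<le> (exp \<bar>Im z\<bar> + exp \<bar>Im z\<bar>) / 2"
    by (intro divide_right_mono add_mono) auto
  finally show ?thesis by simp
qed

lemma norm_csinc_le_exp:
  assumes "0 \<le> d" shows "norm (csinc d u) \<le> d * exp (pi * d * norm u)"
proof (cases "u = 0")
  case False
  define v where "v = of_real (pi * d) * u"
  have v: "norm v = pi * d * norm u" using assms by (simp add: v_def norm_mult)
  have "norm (sin v - sin 0) \<le> exp (norm v) * norm (v - 0)"
  proof (rule field_differentiable_bound[of "cball 0 (norm v)" sin cos])
    show "norm (cos x) \<le> exp (norm v)" if "x \<in> cball 0 (norm v)" for x :: complex
      using norm_cos_le[of x] that by (auto intro: order_trans)
  qed (auto intro!: derivative_eq_intros)
  then have "norm (sin v) \<le> exp (norm v) * (pi * d * norm u)" by (simp add: v)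
  then show ?thesis
    using False unfolding csinc_def v_def[symmetric]
    by (simp add: norm_divide norm_mult field_simps v)
qed (use assms in simp)

lemma norm_csinc_le_strip:
  assumes "0 \<le> d" shows "norm (csinc d u) * (pi * norm u) \<le> exp (pi * d * \<bar>Im u\<bar>)"
proof -
  have "norm (csinc d u) * (pi * norm u) = norm (of_real pi * u * csinc d u)" by (simp add: norm_mult)
  also have "\<dots> \<le> exp \<bar>Im (of_real (pi * d) * u)\<bar>" unfolding csinc_mult by (rule norm_sin_le_exp_Im)
  also have "\<bar>Im (of_real (pi * d) * u)\<bar> = pi * d * \<bar>Im u\<bar>" using assms by (simp add: abs_mult)
  finally show ?thesis by simp
qed

text \<open>The mean value bound serves within distance 1 of \<open>w\<close>, the bound on the sine
  beyond it. What matters is that the constant depends on \<open>D\<close> and not on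
  \<open>d\<close>: this provides a common majorant for kernels of varying type.\<close>

lemma norm_csinc_decay:
  fixes x :: real
  assumes d: "0 \<le> d" "d \<le> D"
  shows "norm (csinc d (of_real x - w)) \<le> (1 + norm w) * (2 + D) * exp (pi * D * (1 + \<bar>Im w\<bar>)) / (1 + \<bar>x\<bar>)"
proof -
  define u where "u = of_real x - w"
  define E where "E = exp (pi * D * (1 + \<bar>Im w\<bar>))"
  have Imu: "\<bar>Im u\<bar> = \<bar>Im w\<bar>" by (simp add: u_def)
  have E1: "1 \<le> E" using d by (simp add: E_def)
  have "norm (csinc d u) * norm u \<le> norm (csinc d u) * (pi * norm u)"
    using pi_ge_two by (intro mult_left_mono) (auto simp: mult_le_cancel_right1)
  also have "\<dots> \<le> exp (pi * d * \<bar>Im w\<bar>)" using norm_csinc_le_strip[OF d(1), of u] Imu by simp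
  also have "\<dots> \<le> E" unfolding E_def using d by (auto intro!: mult_mono)
  finally have 1: "norm (csinc d u) * norm u \<le> E" .
  have 2: "norm (csinc d u) \<le> (if norm u \<le> 1 then D * E else E)"
  proof (cases "norm u \<le> 1")
    case True
    have "norm (csinc d u) \<le> d * exp (pi * d * norm u)" by (rule norm_csinc_le_exp[OF d(1)])
    also have "\<dots> \<le> D * E" unfolding E_def using d True by (auto intro!: mult_mono)
    finally show ?thesis using True by simp
  next
    case False
    then have "norm (csinc d u) * 1 \<le> norm (csinc d u) * norm u" by (intro mult_left_mono) auto
    with 1 False show ?thesis by simp
  qed
  have 3: "norm (csinc d u) * (1 + norm u) \<le> (1 + D) * E + E"
  proof -
    have "0 \<le> D * E" using d E1 by auto
    then show ?thesis using 1 2 E1 by (auto simp: algebra_simps split: if_splits)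
  qed
  have "1 + \<bar>x\<bar> \<le> 1 + (norm u + norm w)"
    using norm_triangle_ineq[of u w] by (simp add: u_def)
  also have "\<dots> \<le> (1 + norm u) * (1 + norm w)" by (simp add: algebra_simps)
  finally have "norm (csinc d u) * (1 + \<bar>x\<bar>) \<le> norm (csinc d u) * ((1 + norm u) * (1 + norm w))"
    by (intro mult_left_mono) auto
  also have "\<dots> \<le> ((1 + D) * E + E) * (1 + norm w)"
    using mult_right_mono[OF 3, of "1 + norm w"] by (simp add: mult.assoc)
  finally show ?thesis
    unfolding u_def[symmetric] E_def[symmetric] by (simp add: pos_le_divide_eq algebra_simps)
qed

section \<open>The reproducing formula of the Paley--Wiener space\<close>

text \<open>The increment of \<open>g\<close> is the integral of \<open>H\<close> over a segment of
  the real line, which is exchanged for the other three sides of a rectangle of height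
  \<open>R\<close>. On the vertical sides the exponential has a bounded integral and the factor
  \<open>norm (z - w)\<close> supplies the decay; on the top side the exponential itself is small.
  Using the primitive makes the change of path automatic.\<close>

lemma half_plane_integral_tendsto_0:
  fixes H g :: "complex \<Rightarrow> complex"
  assumes g: "\<And>z. (g has_field_derivative H z) (at z)" and a: "0 < a"
    and bound: "\<And>z. 0 \<le> Im z \<Longrightarrow> norm (H z) * norm (z - w) \<le> C * exp (- (a * Im z))"
  shows "((\<lambda>R. g (of_real R) - g (- of_real R)) \<longlongrightarrow> 0) at_top"
proof (rule Lim_null_comparison)
  define q where "q = norm w"
  have C: "0 \<le> C" using order_trans[OF mult_nonneg_nonneg[OF norm_ge_zero norm_ge_zero] bound[of 0]] by simp
  have q: "0 \<le> q" by (simp add: q_def)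
  have HR: "norm (H z) \<le> C * exp (- (a * Im z)) / (R - q)" if "q < R" "0 \<le> Im z" "R \<le> norm z" for z R
  proof -
    have "norm (H z) * (R - q) \<le> norm (H z) * norm (z - w)"
      using that norm_triangle_ineq2[of z w] by (intro mult_left_mono) (auto simp: q_def)
    also have "\<dots> \<le> C * exp (- (a * Im z))" by (rule bound) fact
    finally show ?thesis using that by (simp add: pos_le_divide_eq)
  qed
  have vert: "norm (g (c + \<i> * of_real R) - g c) \<le> C / (a * (R - q))"
    if "q < R" "\<bar>Re c\<bar> = R" "Im c = 0" for c R
  proof -
    define K where "K = C / (R - q)"
    have K: "0 \<le> K" "K / a = C / (a * (R - q))" using C that by (auto simp: K_def)
    \<comment> \<open>An antiderivative of the bound \<open>K * exp (- (a * y))\<close>, so that the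
      growth of \<open>g\<close> along the side is compared with a function of bounded total
      increase \<open>K / a\<close>.\<close>
    define \<phi> where "\<phi> = (\<lambda>y::real. - (K / a) * exp (- (a * y)))"
    have "norm (g (c + \<i> * of_real R) - g (c + \<i> * of_real 0)) \<le> \<phi> R - \<phi> 0"
    proof (rule differentiable_bound_general)
      show "0 < R" using that q by simp
      show "continuous_on {0..R} (\<lambda>y. g (c + \<i> * of_real y))"
        by (rule continuous_on_vector_derivative, rule has_vector_derivative_vertical[OF g])
      show "continuous_on {0..R} \<phi>" unfolding \<phi>_def by (intro continuous_intros)
      show "((\<lambda>y. g (c + \<i> * of_real y)) has_vector_derivative \<i> * H (c + \<i> * of_real y)) (at y)" for y
        by (rule has_vector_derivative_vertical[OF g])
      show "(\<phi> has_vector_derivative K * exp (- (a * y))) (at y)" for y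
        unfolding \<phi>_def has_real_derivative_iff_has_vector_derivative[symmetric]
        using a by (auto intro!: derivative_eq_intros)
      fix y :: real assume "0 < y"
      then have "norm (H (c + \<i> * of_real y)) \<le> C * exp (- (a * Im (c + \<i> * of_real y))) / (R - q)"
        using that abs_Re_le_cmod[of "c + \<i> * of_real y"] by (intro HR) auto
      then show "norm (\<i> * H (c + \<i> * of_real y)) \<le> K * exp (- (a * y))"
        using that by (simp add: norm_mult K_def)
    qed
    also have "\<phi> R - \<phi> 0 \<le> C / (a * (R - q))"
      unfolding K(2)[symmetric] using K(1) a by (simp add: \<phi>_def)
    finally show ?thesis by simp
  qed
  show "\<forall>\<^sub>F R in at_top. norm (g (of_real R) - g (- of_real R)) \<le>
      2 * (C / (a * (R - q))) + C * exp (- (a * R)) / (R - q) * (2 * R)"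
    using eventually_gt_at_top[of q]
  proof eventually_elim
    case (elim R)
    define u v where "u = complex_of_real R + \<i> * of_real R" and "v = - complex_of_real R + \<i> * of_real R"
    have "norm (g u - g (of_real R)) \<le> C / (a * (R - q))"
      unfolding u_def using elim q by (intro vert) auto
    moreover have "norm (g v - g (- of_real R)) \<le> C / (a * (R - q))"
      unfolding v_def using elim q by (intro vert) auto
    moreover have "norm (g u - g v) \<le> C * exp (- (a * R)) / (R - q) * norm (u - v)"
    proof (rule field_differentiable_bound)
      show "convex {z. Im z = R}"
        by (simp add: convex_def algebra_simps flip: distrib_right)
      show "norm (H z) \<le> C * exp (- (a * R)) / (R - q)" if "z \<in> {z. Im z = R}" for z
        using HR[of R z] that elim q abs_Im_le_cmod[of z] by auto
    qed (auto simp: u_def v_def intro: has_field_derivative_at_within g)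
    moreover have "norm (u - v) = 2 * R"
    proof -
      have "u - v = of_real (2 * R)" by (simp add: u_def v_def)
      then show ?thesis using elim q by (simp only: norm_of_real)
    qed
    moreover have "g (of_real R) - g (- of_real R) = (g u - g v) - (g u - g (of_real R)) + (g v - g (- of_real R))"
      by simp
    then have "norm (g (of_real R) - g (- of_real R)) \<le>
        norm (g u - g v) + norm (g u - g (of_real R)) + norm (g v - g (- of_real R))"
      using norm_triangle_ineq norm_triangle_ineq4 order_trans add_right_mono by (metis (no_types, lifting))
    ultimately show ?case by simp
  qed
  show "((\<lambda>R. 2 * (C / (a * (R - q))) + C * exp (- (a * R)) / (R - q) * (2 * R)) \<longlongrightarrow> 0) at_top"
  proof (cases "C = 0")
    case False
    then have "0 < C" using C by simp
    then show ?thesis using a by real_asymp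
  qed simp
qed

lemma csinc_of_real: "csinc d (of_real x) = of_real (d * sinc (pi * d * x))" if "d \<noteq> 0"
  using that by (auto simp: csinc_def sin_of_real simp flip: of_real_mult of_real_divide)

text \<open>For \<open>w = 0\<close> this is the Dirichlet integral in the form of the limit of
  \<open>Si\<close>. A complex shift moves each end point by the fixed distance
  \<open>norm w\<close> through a region where \<open>csinc d\<close> is of order 1/R, hence changes
  nothing in the limit.\<close>

lemma csinc_primitive_tendsto:
  assumes S: "\<And>z. (S has_field_derivative csinc d z) (at z)" and d: "0 < d"
  shows "((\<lambda>R. S (of_real R - w) - S (- of_real R - w)) \<longlongrightarrow> 1) at_top"
proof -
  have D: "((\<lambda>x::real. S (of_real x) - of_real (Si (pi * d * x) / pi)) has_vector_derivative 0) (at x)" for x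
  proof -
    have "((\<lambda>x. Si (pi * d * x) / pi) has_real_derivative d * sinc (pi * d * x)) (at x)"
      using d by (auto intro!: derivative_eq_intros DERIV_chain'[OF _ DERIV_Si, of "\<lambda>x. pi * d * x"])
    then have "((\<lambda>x. complex_of_real (Si (pi * d * x) / pi)) has_vector_derivative of_real (d * sinc (pi * d * x))) (at x)"
      unfolding has_real_derivative_iff_has_vector_derivative
      by (rule bounded_linear.has_vector_derivative[OF bounded_linear_of_real])
    moreover have "((\<lambda>x::real. S (of_real x)) has_vector_derivative csinc d (of_real x)) (at x)"
      using has_vector_derivative_horizontal[OF S, of 0] by simp
    ultimately show ?thesis
      using csinc_of_real[of d x] d has_vector_derivative_diff by fastforce
  qed
  have S0: "S (of_real R) - S (- of_real R) = of_real (2 * Si (pi * d * R) / pi)" if "0 \<le> R" for R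
  proof -
    have "S (of_real R) - of_real (Si (pi * d * R) / pi) = S (of_real (-R)) - of_real (Si (pi * d * (-R)) / pi)"
      by (rule has_derivative_zero_unique[OF convex_UNIV, of "\<lambda>x::real. S (of_real x) - of_real (Si (pi * d * x) / pi)"])
         (use D in \<open>auto simp: has_vector_derivative_def\<close>)
    moreover have "Si (pi * d * (-R)) = - Si (pi * d * R)"
      using Si_neg[of "pi * d * R"] d that by simp
    ultimately show ?thesis by (simp add: algebra_simps)
  qed
  have "((\<lambda>R. complex_of_real (2 * Si (pi * d * R) / pi)) \<longlongrightarrow> of_real (2 * (pi/2) / pi)) at_top"
    by (intro tendsto_intros filterlim_compose[OF Si_at_top]) (use d in \<open>auto, real_asymp\<close>)
  then have "((\<lambda>R. complex_of_real (2 * Si (pi * d * R) / pi)) \<longlongrightarrow> 1) at_top" by simp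
  then have lim0: "((\<lambda>R. S (of_real R) - S (- of_real R)) \<longlongrightarrow> 1) at_top"
    by (rule Lim_transform_eventually)
       (use eventually_ge_at_top[of 0] in \<open>eventually_elim, simp add: S0\<close>)
  have shift: "((\<lambda>R. S (c * of_real R - w) - S (c * of_real R)) \<longlongrightarrow> 0) at_top" if c: "c = 1 \<or> c = -1" for c :: complex
  proof (rule Lim_null_comparison)
    define q where "q = norm w"
    have q: "0 \<le> q" by (simp add: q_def)
    show "\<forall>\<^sub>F R in at_top. norm (S (c * of_real R - w) - S (c * of_real R)) \<le>
        exp (pi * d * q) / (pi * (R - q)) * q"
      using eventually_gt_at_top[of q]
    proof eventually_elim
      case (elim R)
      have "norm (S (c * of_real R - w) - S (c * of_real R)) \<le>
          exp (pi * d * q) / (pi * (R - q)) * norm ((c * of_real R - w) - c * of_real R)"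
      proof (rule field_differentiable_bound[of "cball (c * of_real R) q"])
        fix z assume z: "z \<in> cball (c * of_real R) q"
        have "\<bar>Im z\<bar> \<le> q"
          using abs_Im_le_cmod[of "c * of_real R - z"] c z by (auto simp: dist_norm)
        have "R - q \<le> norm z"
          using norm_triangle_ineq2[of "c * of_real R" "c * of_real R - z"] c z q elim
          by (auto simp: dist_norm norm_mult)
        then have "norm (csinc d z) * (pi * (R - q)) \<le> norm (csinc d z) * (pi * norm z)"
          by (intro mult_left_mono) auto
        also have "\<dots> \<le> exp (pi * d * \<bar>Im z\<bar>)" using norm_csinc_le_strip d by simp
        also have "\<dots> \<le> exp (pi * d * q)" using \<open>\<bar>Im z\<bar> \<le> q\<close> d by simp
        finally show "norm (csinc d z) \<le> exp (pi * d * q) / (pi * (R - q))"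
          using elim by (simp add: pos_le_divide_eq)
      qed (use q in \<open>auto simp: dist_norm q_def intro: has_field_derivative_at_within S\<close>)
      then show ?case by (simp add: q_def)
    qed
    show "((\<lambda>R. exp (pi * d * q) / (pi * (R - q)) * q) \<longlongrightarrow> 0) at_top"
      by real_asymp
  qed
  have "((\<lambda>R. (S (1 * of_real R - w) - S (1 * of_real R)) - (S ((-1) * of_real R - w) - S ((-1) * of_real R))
      + (S (of_real R) - S (- of_real R))) \<longlongrightarrow> 0 - 0 + 1) at_top"
    by (intro tendsto_intros shift lim0) auto
  then show ?thesis by simp
qed

text \<open>A bounded \<open>F\<close> times \<open>csinc d\<close> need not be absolutely
  integrable, so the statement is a limit of symmetric truncations. The strict gap between \<sigma>
  and \<open>pi * d\<close> supplies the decay rate for the change of contour.\<close>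

lemma sin_kernel_tendsto:
  fixes F :: "complex \<Rightarrow> complex"
  assumes F: "F holomorphic_on UNIV" and bound: "\<And>z. norm (F z) \<le> C * exp (\<sigma> * \<bar>Im z\<bar>)"
    and \<sigma>: "0 \<le> \<sigma>" "\<sigma> < pi * d"
  shows "((\<lambda>R. LINT x|lborel. indicator {-R..R} x *\<^sub>R (F (of_real x) * csinc d (of_real x - w))) \<longlongrightarrow> F w) at_top"
proof -
  define s where "s = pi * d"
  define Q where "Q = (\<lambda>z. if z = w then deriv F w else (F z - F w) / (z - w))"
  have holQ: "Q holomorphic_on UNIV" unfolding Q_def by (rule pole_lemma[OF F]) auto
  have d: "0 < d" using order_le_less_trans[OF \<sigma>] by (simp add: zero_less_mult_iff)
  have C: "0 \<le> C" using order_trans[OF norm_ge_zero bound[of 0]] by simp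
  define A where "A = C + norm (F w)"
  have Qb: "norm (Q z) * norm (z - w) \<le> A * exp (\<sigma> * \<bar>Im z\<bar>)" for z
  proof (cases "z = w")
    case False
    then have "norm (Q z) * norm (z - w) = norm (F z - F w)" by (simp add: Q_def norm_divide)
    also have "\<dots> \<le> C * exp (\<sigma> * \<bar>Im z\<bar>) + norm (F w)"
      using norm_triangle_ineq4[of "F z" "F w"] bound[of z] by linarith
    also have "\<dots> \<le> C * exp (\<sigma> * \<bar>Im z\<bar>) + norm (F w) * exp (\<sigma> * \<bar>Im z\<bar>)"
      using \<sigma> mult_left_mono[of 1 "exp (\<sigma> * \<bar>Im z\<bar>)" "norm (F w)"] by simp
    finally show ?thesis by (simp add: A_def algebra_simps)
  qed (use C in \<open>simp add: A_def\<close>)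
  have "(\<lambda>z. Q z * exp (\<i> * s * (z - w))) holomorphic_on UNIV"
    by (intro holomorphic_intros holQ)
  then obtain g1 where g1: "\<And>z. (g1 has_field_derivative Q z * exp (\<i> * s * (z - w))) (at z)"
    using entire_primitive by blast
  have "(\<lambda>z. Q z * exp (- (\<i> * s * (z - w)))) holomorphic_on UNIV"
    by (intro holomorphic_intros holQ)
  then obtain g2 where g2: "\<And>z. (g2 has_field_derivative Q z * exp (- (\<i> * s * (z - w)))) (at z)"
    using entire_primitive by blast
  obtain S where S: "\<And>z. (S has_field_derivative csinc d z) (at z)"
    using entire_primitive[OF holomorphic_csinc] by blast
  have lim1: "((\<lambda>R. g1 (of_real R) - g1 (- of_real R)) \<longlongrightarrow> 0) at_top"
  proof (rule half_plane_integral_tendsto_0[OF g1])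
    fix z :: complex assume z: "0 \<le> Im z"
    have "norm (Q z * exp (\<i> * s * (z - w))) * norm (z - w) = (norm (Q z) * norm (z - w)) * exp (- (s * (Im z - Im w)))"
      by (simp add: norm_mult)
    also have "\<dots> \<le> A * exp (\<sigma> * \<bar>Im z\<bar>) * exp (- (s * (Im z - Im w)))"
      by (intro mult_right_mono Qb) auto
    also have "\<dots> = A * exp (s * Im w) * exp (- ((s - \<sigma>) * Im z))"
      using z by (simp add: mult.assoc algebra_simps flip: exp_add)
    finally show "norm (Q z * exp (\<i> * s * (z - w))) * norm (z - w) \<le> A * exp (s * Im w) * exp (- ((s - \<sigma>) * Im z))" .
  qed (use \<sigma> in \<open>simp add: s_def\<close>)
  \<comment> \<open>The second exponential decays in the lower half plane. Replacing
    \<open>z\<close> by \<open>- z\<close> moves it to the upper one, with \<open>- w\<close> in the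
    place of \<open>w\<close>.\<close>
  have g2': "((\<lambda>z. - g2 (- z)) has_field_derivative Q (-z) * exp (- (\<i> * s * (-z - w)))) (at z)" for z
    using DERIV_minus[OF DERIV_chain2[OF g2[of "-z"] DERIV_minus[OF DERIV_ident]]] by simp
  have lim2: "((\<lambda>R. - g2 (- of_real R) - - g2 (- (- of_real R))) \<longlongrightarrow> 0) at_top"
  proof (rule half_plane_integral_tendsto_0[OF g2'])
    fix z :: complex assume z: "0 \<le> Im z"
    have "norm (Q (-z) * exp (- (\<i> * s * (-z - w)))) * norm (z - (-w)) = (norm (Q (-z)) * norm (-z - w)) * exp (- (s * (Im z + Im w)))"
    proof -
      have "norm (z - (-w)) = norm (-z - w)" using norm_minus_cancel[of "z + w"] by simp
      then show ?thesis by (simp add: norm_mult algebra_simps)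
    qed
    also have "\<dots> \<le> A * exp (\<sigma> * \<bar>Im z\<bar>) * exp (- (s * (Im z + Im w)))"
      using Qb[of "-z"] by (intro mult_right_mono) auto
    also have "\<dots> = A * exp (- (s * Im w)) * exp (- ((s - \<sigma>) * Im z))"
      using z by (simp add: mult.assoc algebra_simps flip: exp_add)
    finally show "norm (Q (-z) * exp (- (\<i> * s * (-z - w)))) * norm (z - (-w)) \<le> A * exp (- (s * Im w)) * exp (- ((s - \<sigma>) * Im z))" .
  qed (use \<sigma> in \<open>simp add: s_def\<close>)
  \<comment> \<open>The constant \<open>F w\<close> contributes the Dirichlet part and the
    difference quotient the two exponentials of the sine. Together they form a primitive of the
    whole integrand, whose increments are the truncated integrals.\<close>
  define P where "P = (\<lambda>z. F w * S (z - w) + (g1 z - g2 z) / (2 * \<i> * of_real pi))"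
  have Sw: "((\<lambda>z. S (z - w)) has_field_derivative csinc d (z - w)) (at z)" for z
    using DERIV_chain2[OF S DERIV_diff[OF DERIV_ident DERIV_const]] by simp
  have P: "(P has_field_derivative F z * csinc d (z - w)) (at z)" for z
  proof -
    have "(P has_field_derivative F w * csinc d (z - w) +
        (Q z * exp (\<i> * s * (z - w)) - Q z * exp (- (\<i> * s * (z - w)))) / (2 * \<i> * of_real pi)) (at z)"
      unfolding P_def
      by (intro DERIV_add DERIV_cmult DERIV_cdivide DERIV_diff g1 g2 Sw)
    also have "F w * csinc d (z - w) +
        (Q z * exp (\<i> * s * (z - w)) - Q z * exp (- (\<i> * s * (z - w)))) / (2 * \<i> * of_real pi) = F z * csinc d (z - w)"
    proof -
      have "(Q z * exp (\<i> * s * (z - w)) - Q z * exp (- (\<i> * s * (z - w)))) / (2 * \<i> * of_real pi)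
          = Q z * sin (of_real s * (z - w)) / of_real pi"
        by (simp add: sin_exp_eq field_simps)
      also have "\<dots> = (F z - F w) * csinc d (z - w)"
        by (simp add: Q_def csinc_def s_def)
      finally show ?thesis by (simp add: algebra_simps)
    qed
    finally show ?thesis .
  qed
  have "((\<lambda>R. F w * (S (of_real R - w) - S (- of_real R - w)) + ((g1 (of_real R) - g1 (- of_real R))
      - (- g2 (- of_real R) - - g2 (- (- of_real R)))) / (2 * \<i> * of_real pi)) \<longlongrightarrow>
      F w * 1 + (0 - 0) / (2 * \<i> * of_real pi)) at_top"
    by (intro tendsto_intros csinc_primitive_tendsto[OF S d] lim1 lim2) auto
  then have "((\<lambda>R. P (of_real R) - P (of_real (-R))) \<longlongrightarrow> F w) at_top"
    by (simp add: P_def algebra_simps add_divide_distrib diff_divide_distrib)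
  then show ?thesis
  proof (rule Lim_transform_eventually)
    have cont: "continuous_on UNIV (\<lambda>z. F z * csinc d (z - w))"
      by (intro continuous_intros holomorphic_on_imp_continuous_on[OF F] continuous_on_compose2[OF continuous_csinc[of UNIV]]) auto
    show "\<forall>\<^sub>F R in at_top. P (of_real R) - P (of_real (-R)) =
        (LINT x|lborel. indicator {-R..R} x *\<^sub>R (F (of_real x) * csinc d (of_real x - w)))"
      using eventually_ge_at_top[of 0]
      by eventually_elim (subst integral_Icc_primitive[OF P cont], auto)
  qed
qed

section \<open>Absolute integrability against \<open>csinc\<close>, and the critical type\<close>

lemma borel_measurable_of_real_compose:
  fixes F :: "complex \<Rightarrow> complex"
  assumes "continuous_on UNIV F"
  shows "(\<lambda>x::real. F (of_real x)) \<in> borel_measurable lborel"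
proof -
  have "continuous_on UNIV (\<lambda>x::real. F (of_real x))"
    by (rule continuous_on_compose2[OF assms continuous_on_of_real[OF continuous_on_id]]) auto
  then show ?thesis by (simp add: borel_measurable_continuous_onI)
qed

lemma borel_measurable_mult_csinc:
  fixes F :: "complex \<Rightarrow> complex"
  assumes "continuous_on UNIV F"
  shows "(\<lambda>x::real. F (of_real x) * csinc d (of_real x - w)) \<in> borel_measurable lborel"
  by (rule borel_measurable_of_real_compose[of "\<lambda>z::complex. F z * csinc d (z - w)"])
     (intro continuous_intros assms continuous_on_compose2[OF continuous_csinc[of UNIV]], auto)

text \<open>Integrability with the weight \<open>1 / (1 + \<bar>x\<bar>)\<close> is the condition
  matched to the decay of \<open>csinc\<close>. It covers both later uses: square integrable
  functions, and integrable products of two of them.\<close>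

lemma integrable_mult_csinc:
  fixes F :: "complex \<Rightarrow> complex"
  assumes F: "continuous_on UNIV F" and int: "integrable lborel (\<lambda>x::real. norm (F (of_real x)) / (1 + \<bar>x\<bar>))"
    and d: "0 \<le> d"
  shows "integrable lborel (\<lambda>x::real. F (of_real x) * csinc d (of_real x - w))"
proof (rule Bochner_Integration.integrable_bound)
  show "integrable lborel (\<lambda>x. (1 + norm w) * (2 + d) * exp (pi * d * (1 + \<bar>Im w\<bar>)) * (norm (F (of_real x)) / (1 + \<bar>x\<bar>)))"
    using int by (rule integrable_mult_right)
  show "(\<lambda>x. F (of_real x) * csinc d (of_real x - w)) \<in> borel_measurable lborel"
    by (rule borel_measurable_mult_csinc) (fact F)
  show "AE x in lborel. norm (F (of_real x) * csinc d (of_real x - w)) \<le>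
      norm ((1 + norm w) * (2 + d) * exp (pi * d * (1 + \<bar>Im w\<bar>)) * (norm (F (of_real x)) / (1 + \<bar>x\<bar>)))"
  proof (rule AE_I2)
    fix x :: real
    show "norm (F (of_real x) * csinc d (of_real x - w)) \<le>
      norm ((1 + norm w) * (2 + d) * exp (pi * d * (1 + \<bar>Im w\<bar>)) * (norm (F (of_real x)) / (1 + \<bar>x\<bar>)))"
      using mult_left_mono[OF norm_csinc_decay[OF d order_refl, of x w] norm_ge_zero[of "F (of_real x)"]] d
      by (simp add: norm_mult mult_ac abs_mult)
  qed
qed

text \<open>The kernel of slightly larger type is handled by the contour shift; dominated
  convergence then lets the type decrease to the critical value.\<close>

theorem exp_type_le_reproducing:
  assumes F: "exp_type_le (pi * d) F" and d: "0 < d"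
    and M: "\<And>x::real. norm (F (of_real x)) \<le> M"
    and int: "integrable lborel (\<lambda>x::real. norm (F (of_real x)) / (1 + \<bar>x\<bar>))"
  shows "(LINT x|lborel. F (of_real x) * csinc d (of_real x - w)) = F w"
proof -
  note holF = exp_type_le_holomorphic[OF F]
  note contF = holomorphic_on_imp_continuous_on[OF holF]
  have gt: "(LINT x|lborel. F (of_real x) * csinc d' (of_real x - w)) = F w" if d': "d < d'" for d'
  proof -
    define \<sigma> where "\<sigma> = pi * ((d + d') / 2)"
    have \<sigma>: "pi * d < \<sigma>" "\<sigma> < pi * d'" "0 \<le> \<sigma>" using d d' by (auto simp: \<sigma>_def)
    obtain C where "\<And>z. norm (F z) \<le> C * exp (\<sigma> * \<bar>Im z\<bar>)"
      using exp_type_le_strip_bound[OF F \<sigma>(1) M] by blast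
    from sin_kernel_tendsto[OF holF this \<sigma>(3,2)]
    have "((\<lambda>R. LINT x|lborel. indicator {-R..R} x *\<^sub>R (F (of_real x) * csinc d' (of_real x - w))) \<longlongrightarrow> F w) at_top" .
    moreover have "((\<lambda>R. LINT x|lborel. indicator {-R..R} x *\<^sub>R (F (of_real x) * csinc d' (of_real x - w))) \<longlongrightarrow>
        (LINT x|lborel. F (of_real x) * csinc d' (of_real x - w))) at_top"
    proof (rule integral_dominated_convergence_at_top)
      have i: "integrable lborel (\<lambda>x::real. F (of_real x) * csinc d' (of_real x - w))"
        using d d' by (intro integrable_mult_csinc contF int) auto
      then show "integrable lborel (\<lambda>x::real. norm (F (of_real x) * csinc d' (of_real x - w)))"
        by (rule integrable_norm)
      show [measurable]: "(\<lambda>x::real. F (of_real x) * csinc d' (of_real x - w)) \<in> borel_measurable lborel"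
        using i by (rule borel_measurable_integrable)
      show "(\<lambda>x. indicator {-R..R} x *\<^sub>R (F (of_real x) * csinc d' (of_real x - w))) \<in> borel_measurable lborel" for R
        by (measurable)
      show "AE x in lborel. ((\<lambda>R. indicator {-R..R} x *\<^sub>R (F (of_real x) * csinc d' (of_real x - w))) \<longlongrightarrow>
          F (of_real x) * csinc d' (of_real x - w)) at_top"
      proof (rule AE_I2)
        fix x :: real
        have "\<forall>\<^sub>F R in at_top. indicator {-R..R} x *\<^sub>R (F (of_real x) * csinc d' (of_real x - w)) = F (of_real x) * csinc d' (of_real x - w)"
          using eventually_ge_at_top[of "\<bar>x\<bar>"] by eventually_elim (auto simp: indicator_def)
        then show "((\<lambda>R. indicator {-R..R} x *\<^sub>R (F (of_real x) * csinc d' (of_real x - w))) \<longlongrightarrow>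
          F (of_real x) * csinc d' (of_real x - w)) at_top" by (rule tendsto_eventually)
      qed
    qed (auto split: split_indicator intro!: always_eventually)
    ultimately show ?thesis by (intro tendsto_unique[OF trivial_limit_at_top_linorder])
  qed
  define e where "e = (\<lambda>n::nat. d + 1 / real (Suc n))"
  have e: "d < e n" "e n \<le> d + 1" for n by (auto simp: e_def field_simps)
  have elim: "e \<longlonglongrightarrow> d"
    unfolding e_def using tendsto_add[OF tendsto_const[of d] LIMSEQ_Suc[OF lim_1_over_n]] by simp
  \<comment> \<open>The decay constant taken at \<open>D = d + 1\<close>, valid for every
    \<open>csinc (e n)\<close> at once.\<close>
  define K where "K = (1 + norm w) * (2 + (d + 1)) * exp (pi * (d + 1) * (1 + \<bar>Im w\<bar>))"
  have meas: "(\<lambda>x::real. F (of_real x) * csinc d' (of_real x - w)) \<in> borel_measurable lborel" for d'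
    by (rule borel_measurable_mult_csinc) (fact contF)
  have "(\<lambda>n. LINT x|lborel. F (of_real x) * csinc (e n) (of_real x - w)) \<longlonglongrightarrow>
      (LINT x|lborel. F (of_real x) * csinc d (of_real x - w))"
  proof (rule integral_dominated_convergence)
    show "integrable lborel (\<lambda>x. K * (norm (F (of_real x)) / (1 + \<bar>x\<bar>)))"
      using int by (rule integrable_mult_right)
    show "AE x in lborel. norm (F (of_real x) * csinc (e n) (of_real x - w)) \<le> K * (norm (F (of_real x)) / (1 + \<bar>x\<bar>))" for n
    proof (rule AE_I2)
      fix x :: real
      show "norm (F (of_real x) * csinc (e n) (of_real x - w)) \<le> K * (norm (F (of_real x)) / (1 + \<bar>x\<bar>))"
        using mult_left_mono[OF norm_csinc_decay[OF _ e(2)[of n], of x w] norm_ge_zero[of "F (of_real x)"]] d e(1)[of n]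
        by (simp add: norm_mult mult_ac K_def)
    qed
    show "AE x in lborel. (\<lambda>n. F (of_real x) * csinc (e n) (of_real x - w)) \<longlonglongrightarrow> F (of_real x) * csinc d (of_real x - w)"
    proof (rule AE_I2)
      fix x :: real
      have "(\<lambda>n. csinc (e n) u) \<longlonglongrightarrow> csinc d u" for u
        unfolding csinc_def using elim by (cases "u = 0") (auto intro!: tendsto_intros)
      then show "(\<lambda>n. F (of_real x) * csinc (e n) (of_real x - w)) \<longlonglongrightarrow> F (of_real x) * csinc d (of_real x - w)"
        by (intro tendsto_intros)
    qed
  qed (fact meas)+
  moreover have "(\<lambda>n. LINT x|lborel. F (of_real x) * csinc (e n) (of_real x - w)) \<longlonglongrightarrow> F w"
    using gt[OF e(1)] by simp
  ultimately show ?thesis by (rule LIMSEQ_unique)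
qed

section \<open>The weighted spaces\<close>

lemma exp_type_le_add:
  assumes F: "exp_type_le \<tau> F" and G: "exp_type_le \<tau> G"
  shows "exp_type_le \<tau> (\<lambda>z. F z + G z)"
proof (rule exp_type_leI)
  show "(\<lambda>z. F z + G z) holomorphic_on UNIV"
    by (intro holomorphic_intros exp_type_le_holomorphic[OF F] exp_type_le_holomorphic[OF G])
  fix \<sigma> assume \<sigma>: "\<tau> < \<sigma>"
  obtain A where A: "\<And>z. norm (F z) \<le> A * exp (\<sigma> * norm z)"
    using exp_type_le_bound[OF F \<sigma>] by auto
  obtain B where B: "\<And>z. norm (G z) \<le> B * exp (\<sigma> * norm z)"
    using exp_type_le_bound[OF G \<sigma>] by auto
  have "norm (F z + G z) \<le> (A + B) * exp (\<sigma> * norm z)" for z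
    using norm_triangle_ineq[of "F z" "G z"] A[of z] B[of z] by (simp add: distrib_right)
  then show "\<exists>C. \<forall>z. norm (F z + G z) \<le> C * exp (\<sigma> * norm z)" by blast
qed

lemma exp_type_le_cmult:
  assumes F: "exp_type_le \<tau> F"
  shows "exp_type_le \<tau> (\<lambda>z. c * F z)"
proof (rule exp_type_leI)
  show "(\<lambda>z. c * F z) holomorphic_on UNIV"
    by (intro holomorphic_intros exp_type_le_holomorphic[OF F])
  fix \<sigma> assume \<sigma>: "\<tau> < \<sigma>"
  obtain A where A: "\<And>z. norm (F z) \<le> A * exp (\<sigma> * norm z)"
    using exp_type_le_bound[OF F \<sigma>] by auto
  have "norm (c * F z) \<le> (norm c * A) * exp (\<sigma> * norm z)" for z
    using mult_left_mono[OF A norm_ge_zero[of c]] by (simp add: norm_mult mult.assoc)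
  then show "\<exists>C. \<forall>z. norm (c * F z) \<le> C * exp (\<sigma> * norm z)" by blast
qed

lemma exp_type_le_mono:
  assumes "exp_type_le \<tau> F" "\<tau> \<le> \<upsilon>"
  shows "exp_type_le \<upsilon> F"
proof (rule exp_type_leI)
  show "F holomorphic_on UNIV" using assms by (rule_tac exp_type_le_holomorphic)
  show "\<exists>C. \<forall>z. norm (F z) \<le> C * exp (\<sigma> * norm z)" if "\<upsilon> < \<sigma>" for \<sigma>
    using exp_type_le_bound[OF assms(1), of \<sigma>] assms(2) that by (meson order_le_less_trans)
qed

section \<open>The weight: positivity and two-sided bounds\<close>

text \<open>The half-angle formula turns the weak inequality into a strict one. Strictness is what
  makes the weight positive away from 0.\<close>

lemma sin_less_self: "sin x < x" if "0 < x" for x :: real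
proof (cases "x < pi")
  case True
  have "cos (x/2) < 1" using cos_monotone_0_pi[of 0 "x/2"] that True by simp
  moreover have "0 < cos (x/2)" using that True by (intro cos_gt_zero) auto
  moreover have "0 < sin (x/2)" using that True by (intro sin_gt_zero) auto
  moreover have "sin (x/2) \<le> x/2" using that by (intro sin_x_le_x) auto
  ultimately have "2 * (sin (x/2) * cos (x/2)) < 2 * (x/2 * 1)"
    using that by (intro mult_strict_left_mono mult_le_less_imp_less) auto
  then show ?thesis using sin_double[of "x/2"] by simp
next
  case False
  then show ?thesis using sin_le_one[of x] pi_ge_two by linarith
qed

lemma wSp_eq: "wSp x = 1 - Re (csinc 2 (of_real x)) / 2"
  by (auto simp: wSp_def csinc_def sin_of_real simp flip: of_real_mult of_real_divide)
     (simp_all add: mult_ac)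

text \<open>This form lets a reproducing formula evaluate weighted integrals, because
  \<open>csinc 2\<close> is the Paley-Wiener kernel at 0 for type \<open>2 * pi\<close>. At
  \<open>x = 0\<close> the value 2 of \<open>csinc 2\<close> matches the value 0 of the
  weight.\<close>

lemma of_real_wSp: "complex_of_real (wSp x) = 1 - csinc 2 (of_real x) / 2"
  by (auto simp: wSp_def csinc_def sin_of_real simp flip: of_real_mult of_real_divide)
     (simp_all add: mult_ac)

lemma wSp_minus: "wSp (- x) = wSp x"
  by (simp add: wSp_def)

lemma abs_sinc_le_1: "\<bar>sin u / u\<bar> \<le> 1" for u :: real
  using abs_sin_x_le_abs_x[of u] by (cases "u = 0") (auto simp: abs_divide)

lemma wSp_nonneg: "0 \<le> wSp x" and wSp_le_2: "wSp x \<le> 2"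
  using abs_le_D1[OF abs_sinc_le_1[of "2 * pi * x"]] abs_le_D2[OF abs_sinc_le_1[of "2 * pi * x"]]
  unfolding wSp_def by (simp_all split: if_split del: times_divide_eq_left)

lemma wSp_pos: "0 < wSp x" if "x \<noteq> 0"
proof -
  have "0 < wSp y" if "0 < y" for y
    using sin_less_self[of "2 * pi * y"] that by (simp add: wSp_def divide_less_eq)
  from this[of x] this[of "-x"] that show ?thesis by (cases "0 < x") (auto simp: wSp_minus)
qed

lemma continuous_wSp: "continuous_on A wSp"
  unfolding wSp_eq[abs_def]
  by (intro continuous_intros continuous_on_compose2[OF continuous_csinc[of UNIV]]) (auto intro!: continuous_on_of_real[OF continuous_on_id])

lemma borel_measurable_wSp [measurable]: "wSp \<in> borel_measurable borel"
  by (intro borel_measurable_continuous_onI continuous_wSp)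

lemma wSp_ge_half: "1 / 2 \<le> wSp x" if "1 \<le> \<bar>x\<bar>"
proof -
  have "1 / 2 \<le> wSp y" if y: "1 \<le> y" for y
  proof -
    have "2 * 1 \<le> 2 * pi * y" using y pi_ge_two by (intro mult_mono) auto
    then have "sin (2 * pi * y) \<le> (2 * pi * y) * (1/2)" using sin_le_one[of "2 * pi * y"] by linarith
    then show ?thesis using y by (simp add: wSp_def divide_le_eq)
  qed
  from this[of x] this[of "-x"] that show ?thesis by (cases "0 \<le> x") (auto simp: wSp_minus)
qed

text \<open>Zero is the only zero of the weight: compactness gives a positive minimum on
  \<open>{m..1}\<close>, evenness covers negative arguments, and beyond 1 the bound 1/2 takes
  over.\<close>

lemma wSp_bounded_below:
  assumes "0 < \<delta>"
  obtains c where "0 < c" "\<And>x. \<delta> \<le> \<bar>x\<bar> \<Longrightarrow> c \<le> wSp x"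
proof -
  define m where "m = min \<delta> 1"
  have m: "0 < m" "m \<le> \<delta>" "m \<le> 1" using assms by (auto simp: m_def)
  obtain x0 where x0: "x0 \<in> {m..1}" "\<And>x. x \<in> {m..1} \<Longrightarrow> wSp x0 \<le> wSp x"
    using continuous_attains_inf[OF compact_Icc _ continuous_wSp, of m 1] m by auto
  show ?thesis
  proof (rule that[of "min (wSp x0) (1/2)"])
    show "0 < min (wSp x0) (1/2)" using wSp_pos[of x0] x0 m by auto
    fix x assume x: "\<delta> \<le> \<bar>x\<bar>"
    have "wSp \<bar>x\<bar> = wSp x" by (auto simp: abs_if wSp_minus)
    moreover have "min (wSp x0) (1/2) \<le> wSp \<bar>x\<bar>"
      using x0(2)[of "\<bar>x\<bar>"] wSp_ge_half[of "\<bar>x\<bar>"] x m by (cases "\<bar>x\<bar> \<le> 1") auto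
    ultimately show "min (wSp x0) (1/2) \<le> wSp x" by simp
  qed
qed

section \<open>The spaces as sets of square integrable functions of exponential type\<close>

lemma HS_continuous: "F \<in> HS G \<Delta> \<Longrightarrow> continuous_on UNIV F"
  by (auto simp: HS_def intro: holomorphic_on_imp_continuous_on exp_type_le_holomorphic)

lemma HS_measurable: "F \<in> HS G \<Delta> \<Longrightarrow> (\<lambda>x::real. F (of_real x)) \<in> borel_measurable lborel"
  by (rule borel_measurable_of_real_compose[OF HS_continuous])

text \<open>The weight is at most 2 and, outside the unit interval about 0, at least 1/2; on that
  interval continuity bounds \<open>F\<close>. The bound \<open>B\<close> depends on
  \<open>F\<close>, so this compares the sets and not yet the norms.\<close>

lemma HS_iff:
  "F \<in> HS G \<Delta> \<longleftrightarrow> exp_type_le (pi * \<Delta>) F \<and> integrable lborel (\<lambda>x::real. (norm (F (of_real x)))\<^sup>2)"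
proof (cases "exp_type_le (pi * \<Delta>) F")
  case True
  note cont = holomorphic_on_imp_continuous_on[OF exp_type_le_holomorphic[OF True]]
  have [measurable]: "(\<lambda>x::real. F (of_real x)) \<in> borel_measurable borel"
    using borel_measurable_of_real_compose[OF cont] by simp
  have "integrable lborel (\<lambda>x::real. (norm (F (of_real x)))\<^sup>2)"
    if int: "integrable lborel (\<lambda>x::real. (norm (F (of_real x)))\<^sup>2 * wSp x)"
  proof -
    have "compact ((\<lambda>x::real. F (of_real x)) ` {-1..1})"
      by (intro compact_continuous_image continuous_on_compose2[OF cont] continuous_on_of_real continuous_on_id) auto
    then have "bounded ((\<lambda>x::real. F (of_real x)) ` {-1..1})" by (rule compact_imp_bounded)
    then obtain B where B: "\<And>x. x \<in> {-1..1::real} \<Longrightarrow> norm (F (of_real x)) \<le> B"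
      unfolding bounded_iff by blast
    show ?thesis
    proof (rule Bochner_Integration.integrable_bound)
      show "integrable lborel (\<lambda>x::real. 2 * ((norm (F (of_real x)))\<^sup>2 * wSp x) + B\<^sup>2 * indicator {-1..1} x)"
        using int by (intro Bochner_Integration.integrable_add integrable_mult_right) auto
      show "AE x in lborel. norm ((norm (F (of_real x)))\<^sup>2) \<le> norm (2 * ((norm (F (of_real x)))\<^sup>2 * wSp x) + B\<^sup>2 * indicator {-1..1} x)"
      proof (rule AE_I2)
        fix x :: real
        have "(norm (F (of_real x)))\<^sup>2 \<le> 2 * ((norm (F (of_real x)))\<^sup>2 * wSp x) + B\<^sup>2 * indicator {-1..1} x"
        proof (cases "x \<in> {-1..1}")
          case True
          then have "(norm (F (of_real x)))\<^sup>2 \<le> B\<^sup>2" using B by (intro power_mono) auto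
          then show ?thesis using True wSp_nonneg[of x] by (simp add: add_increasing)
        next
          case False
          then have "1 / 2 \<le> wSp x" by (intro wSp_ge_half) (auto simp: abs_le_iff)
          then show ?thesis using False mult_left_mono[of "1/2" "wSp x" "(norm (F (of_real x)))\<^sup>2"] by simp
        qed
        then show "norm ((norm (F (of_real x)))\<^sup>2) \<le> norm (2 * ((norm (F (of_real x)))\<^sup>2 * wSp x) + B\<^sup>2 * indicator {-1..1} x)"
          by simp
      qed
    qed measurable
  qed
  moreover have "integrable lborel (\<lambda>x::real. (norm (F (of_real x)))\<^sup>2 * wSp x)"
    if int: "integrable lborel (\<lambda>x::real. (norm (F (of_real x)))\<^sup>2)"
  proof (rule Bochner_Integration.integrable_bound)
    show "integrable lborel (\<lambda>x::real. 2 * (norm (F (of_real x)))\<^sup>2)" using int by (rule integrable_mult_right)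
    show "AE x in lborel. norm ((norm (F (of_real x)))\<^sup>2 * wSp x) \<le> norm (2 * (norm (F (of_real x)))\<^sup>2)"
      using wSp_le_2 wSp_nonneg by (auto intro!: AE_I2 mult_mono simp: abs_mult mult.commute)
  qed measurable
  ultimately show ?thesis using True by (auto simp: HS_def)
qed (simp add: HS_def)

lemma HS_exp_type: "F \<in> HS G \<Delta> \<Longrightarrow> exp_type_le (pi * \<Delta>) F"
  by (simp add: HS_def)

lemma HS_L2: "F \<in> HS G \<Delta> \<Longrightarrow> integrable lborel (\<lambda>x::real. (norm (F (of_real x)))\<^sup>2)"
  by (simp add: HS_iff)

lemma HS_eq: "HS G \<Delta> = HS G' \<Delta>"
  by (simp add: HS_def)

lemma HS_lincomb:
  assumes F: "F \<in> HS G \<Delta>" and H: "H \<in> HS G \<Delta>"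
  shows "(\<lambda>z. a * F z + b * H z) \<in> HS G \<Delta>"
  unfolding HS_iff
proof
  show "exp_type_le (pi * \<Delta>) (\<lambda>z. a * F z + b * H z)"
    by (intro exp_type_le_add exp_type_le_cmult HS_exp_type[OF F] HS_exp_type[OF H])
  note [measurable] = HS_measurable[OF F, simplified] HS_measurable[OF H, simplified]
  show "integrable lborel (\<lambda>x::real. (norm (a * F (of_real x) + b * H (of_real x)))\<^sup>2)"
  proof (rule Bochner_Integration.integrable_bound)
    show "integrable lborel (\<lambda>x::real. 2 * (norm a)\<^sup>2 * (norm (F (of_real x)))\<^sup>2 + 2 * (norm b)\<^sup>2 * (norm (H (of_real x)))\<^sup>2)"
      by (intro Bochner_Integration.integrable_add integrable_mult_right HS_L2[OF F] HS_L2[OF H])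
    show "AE x in lborel. norm ((norm (a * F (of_real x) + b * H (of_real x)))\<^sup>2) \<le>
        norm (2 * (norm a)\<^sup>2 * (norm (F (of_real x)))\<^sup>2 + 2 * (norm b)\<^sup>2 * (norm (H (of_real x)))\<^sup>2)"
    proof (rule AE_I2)
      fix x :: real
      have "(norm (u + v))\<^sup>2 \<le> 2 * (norm u)\<^sup>2 + 2 * (norm v)\<^sup>2" for u v :: complex
      proof -
        have "(norm (u + v))\<^sup>2 \<le> (norm u + norm v)\<^sup>2" by (intro power_mono norm_triangle_ineq) auto
        also have "\<dots> \<le> 2 * (norm u)\<^sup>2 + 2 * (norm v)\<^sup>2"
          using zero_le_power2[of "norm u - norm v"] by (simp add: power2_eq_square algebra_simps)
        finally show ?thesis .
      qed
      from this[of "a * F (of_real x)" "b * H (of_real x)"]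
      show "norm ((norm (a * F (of_real x) + b * H (of_real x)))\<^sup>2) \<le>
        norm (2 * (norm a)\<^sup>2 * (norm (F (of_real x)))\<^sup>2 + 2 * (norm b)\<^sup>2 * (norm (H (of_real x)))\<^sup>2)"
        by (simp add: norm_mult power_mult_distrib)
    qed
  qed measurable
qed

lemma integrable_inverse_square: "integrable lborel (\<lambda>x::real. (1 / (1 + \<bar>x\<bar>))\<^sup>2)"
proof (rule Bochner_Integration.integrable_bound)
  show "integrable lborel (\<lambda>x::real. inverse (1 + x\<^sup>2))"
    using integrable_inverse_1_plus_square by (simp add: set_integrable_def einterval_def)
  show "AE x in lborel. norm ((1 / (1 + \<bar>x::real\<bar>))\<^sup>2) \<le> norm (inverse (1 + x\<^sup>2))"
  proof (rule AE_I2)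
    fix x :: real
    have "1 + x\<^sup>2 \<le> (1 + \<bar>x\<bar>)\<^sup>2" by (simp add: power2_eq_square algebra_simps)
    then have "inverse ((1 + \<bar>x\<bar>)\<^sup>2) \<le> inverse (1 + x\<^sup>2)"
      by (intro le_imp_inverse_le) (auto simp: add_pos_nonneg)
    then show "norm ((1 / (1 + \<bar>x\<bar>))\<^sup>2) \<le> norm (inverse (1 + x\<^sup>2))"
      by (simp add: power_divide inverse_eq_divide add_nonneg_nonneg)
  qed
qed measurable

lemma csinc_shift_in_HS:
  assumes "0 < \<Delta>" shows "(\<lambda>z. csinc \<Delta> (z - c)) \<in> HS G \<Delta>"
  unfolding HS_iff
proof
  have hol: "(\<lambda>z. csinc \<Delta> (z - c)) holomorphic_on UNIV"
    by (rule holomorphic_on_compose_gen[OF _ holomorphic_csinc, unfolded o_def]) (auto intro!: holomorphic_intros)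
  show "exp_type_le (pi * \<Delta>) (\<lambda>z. csinc \<Delta> (z - c))"
  proof (rule exp_type_leI[OF hol])
    fix \<sigma> assume \<sigma>: "pi * \<Delta> < \<sigma>"
    have "norm (csinc \<Delta> (z - c)) \<le> \<Delta> * exp (pi * \<Delta> * norm c) * exp (\<sigma> * norm z)" for z
    proof -
      have "norm (csinc \<Delta> (z - c)) \<le> \<Delta> * exp (pi * \<Delta> * norm (z - c))"
        using assms by (intro norm_csinc_le_exp) auto
      also have "pi * \<Delta> * norm (z - c) \<le> pi * \<Delta> * (norm c + norm z)"
        using assms norm_triangle_ineq4[of z c] by (intro mult_left_mono) auto
      also have "\<dots> \<le> pi * \<Delta> * norm c + \<sigma> * norm z"
        using \<sigma> by (simp add: distrib_left mult_right_mono)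
      finally show ?thesis using assms by (simp add: mult.assoc flip: exp_add)
    qed
    then show "\<exists>C. \<forall>z. norm (csinc \<Delta> (z - c)) \<le> C * exp (\<sigma> * norm z)" by blast
  qed
  have m: "(\<lambda>x::real. csinc \<Delta> (of_real x - c)) \<in> borel_measurable lborel"
    using borel_measurable_of_real_compose[OF holomorphic_on_imp_continuous_on[OF hol]] .
  define K where "K = (1 + norm c) * (2 + \<Delta>) * exp (pi * \<Delta> * (1 + \<bar>Im c\<bar>))"
  show "integrable lborel (\<lambda>x::real. (norm (csinc \<Delta> (of_real x - c)))\<^sup>2)"
  proof (rule Bochner_Integration.integrable_bound)
    show "integrable lborel (\<lambda>x::real. K\<^sup>2 * (1 / (1 + \<bar>x\<bar>))\<^sup>2)"
      by (intro integrable_mult_right integrable_inverse_square)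
    show "(\<lambda>x::real. (norm (csinc \<Delta> (of_real x - c)))\<^sup>2) \<in> borel_measurable lborel"
      using m by measurable
    show "AE x in lborel. norm ((norm (csinc \<Delta> (of_real x - c)))\<^sup>2) \<le> norm (K\<^sup>2 * (1 / (1 + \<bar>x\<bar>))\<^sup>2)"
    proof (rule AE_I2)
      fix x :: real
      have "norm (csinc \<Delta> (of_real x - c)) \<le> K * (1 / (1 + \<bar>x\<bar>))"
        using norm_csinc_decay[of \<Delta> \<Delta> x c] assms by (simp add: K_def)
      then have "(norm (csinc \<Delta> (of_real x - c)))\<^sup>2 \<le> (K * (1 / (1 + \<bar>x\<bar>)))\<^sup>2" by (intro power_mono) auto
      then show "norm ((norm (csinc \<Delta> (of_real x - c)))\<^sup>2) \<le> norm (K\<^sup>2 * (1 / (1 + \<bar>x\<bar>))\<^sup>2)"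
        by (simp only: power_mult_distrib) simp
    qed
  qed
qed

lemma HS_bounded:
  assumes F: "F \<in> HS G \<Delta>" and "0 < \<Delta>"
  obtains M where "\<And>x::real. norm (F (of_real x)) \<le> M"
  using exp_type_le_L2_bounded[OF HS_exp_type[OF F] _ HS_L2[OF F]] assms by auto

text \<open>Square integrability of both \<open>F\<close> and \<open>1 / (1 + \<bar>x\<bar>)\<close>
  supplies the integrability condition of the reproducing formula, and membership supplies
  boundedness.\<close>

lemma HS_reproducing:
  assumes F: "F \<in> HS G \<Delta>" and \<Delta>: "0 < \<Delta>"
  shows "(LINT x|lborel. F (of_real x) * csinc \<Delta> (of_real x - w)) = F w"
proof -
  note [measurable] = HS_measurable[OF F, simplified]
  obtain M where M: "\<And>x::real. norm (F (of_real x)) \<le> M" using HS_bounded[OF assms] by blast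
  show ?thesis
  proof (rule exp_type_le_reproducing[OF HS_exp_type[OF F] \<Delta> M])
    show "integrable lborel (\<lambda>x::real. norm (F (of_real x)) / (1 + \<bar>x\<bar>))"
    proof (rule Bochner_Integration.integrable_bound)
      show "integrable lborel (\<lambda>x::real. (norm (F (of_real x)))\<^sup>2 + (1 / (1 + \<bar>x\<bar>))\<^sup>2)"
        by (intro Bochner_Integration.integrable_add HS_L2[OF F] integrable_inverse_square)
      show "AE x in lborel. norm (norm (F (of_real x)) / (1 + \<bar>x\<bar>)) \<le> norm ((norm (F (of_real x)))\<^sup>2 + (1 / (1 + \<bar>x\<bar>))\<^sup>2)"
      proof (rule AE_I2)
        fix x :: real
        have "a * b \<le> a\<^sup>2 + b\<^sup>2" if "0 \<le> a" "0 \<le> b" for a b :: real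
          using zero_le_power2[of "a - b"] mult_nonneg_nonneg[OF that]
          by (simp add: power2_eq_square algebra_simps)
        from this[of "norm (F (of_real x))" "1 / (1 + \<bar>x\<bar>)"]
        show "norm (norm (F (of_real x)) / (1 + \<bar>x\<bar>)) \<le> norm ((norm (F (of_real x)))\<^sup>2 + (1 / (1 + \<bar>x\<bar>))\<^sup>2)"
          by simp
      qed
    qed measurable
  qed
qed

section \<open>Bounded point evaluations\<close>

text \<open>The reproducing formula applied to the kernel itself gives the squared norm as
  \<open>csinc \<Delta> (w - cnj w)\<close>. For real \<open>w\<close> the bound is \<Delta> itself,
  to which the interval in \<open>HS_eval_le\<close> is tuned.\<close>

lemma integral_csinc_norm_sq_le:
  assumes \<Delta>: "0 < \<Delta>"
  shows "(LINT x|lborel. (norm (csinc \<Delta> (of_real x - w)))\<^sup>2) \<le> \<Delta> * exp (2 * pi * \<Delta> * \<bar>Im w\<bar>)"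
proof -
  have "complex_of_real (LINT x|lborel. (norm (csinc \<Delta> (of_real x - w)))\<^sup>2)
      = (LINT x|lborel. csinc \<Delta> (of_real x - cnj w) * csinc \<Delta> (of_real x - w))"
    unfolding integral_complex_of_real[symmetric]
    by (simp only: complex_norm_square cnj_csinc) (simp add: mult.commute)
  also have "\<dots> = csinc \<Delta> (w - cnj w)"
    by (rule HS_reproducing[OF csinc_shift_in_HS[OF \<Delta>] \<Delta>])
  finally have eq: "complex_of_real (LINT x|lborel. (norm (csinc \<Delta> (of_real x - w)))\<^sup>2) = csinc \<Delta> (w - cnj w)" .
  have "(LINT x|lborel. (norm (csinc \<Delta> (of_real x - w)))\<^sup>2) \<le> norm (csinc \<Delta> (w - cnj w))"
    unfolding eq[symmetric] norm_of_real by simp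
  also have "\<dots> \<le> \<Delta> * exp (pi * \<Delta> * norm (w - cnj w))"
    using \<Delta> by (intro norm_csinc_le_exp) auto
  also have "norm (w - cnj w) = 2 * \<bar>Im w\<bar>"
    by (simp add: complex_diff_cnj norm_mult)
  finally show ?thesis by (simp add: mult_ac)
qed

lemma HS_eval_le_L2:
  assumes F: "F \<in> HS G \<Delta>" and \<Delta>: "0 < \<Delta>"
  shows "(norm (F w))\<^sup>2 \<le> \<Delta> * exp (2 * pi * \<Delta> * \<bar>Im w\<bar>) * (LINT x|lborel. (norm (F (of_real x)))\<^sup>2)"
proof (cases "F w = 0")
  case False
  define L where "L = (LINT x|lborel. (norm (F (of_real x)))\<^sup>2)"
  define K where "K = \<Delta> * exp (2 * pi * \<Delta> * \<bar>Im w\<bar>)"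
  define n where "n = norm (F w)"
  define k where "k = (\<lambda>x::real. csinc \<Delta> (of_real x - w))"
  have K: "0 < K" "0 < n" using \<Delta> False by (auto simp: K_def n_def)
  \<comment> \<open>The parameter that makes the weighted arithmetic-geometric inequality as good as
    Cauchy-Schwarz: the kernel term becomes at most \<open>n / 2\<close>, which is absorbed on the
    left and leaves \<open>n * n \<le> K * L\<close>.\<close>
  define t where "t = K / n"
  have t: "0 < t" using K by (simp add: t_def)
  have ik: "integrable lborel (\<lambda>x. (norm (k x))\<^sup>2)"
    unfolding k_def using HS_L2[OF csinc_shift_in_HS[OF \<Delta>]] .
  have mk [measurable]: "k \<in> borel_measurable borel"
    using HS_measurable[OF csinc_shift_in_HS[OF \<Delta>], of w] by (simp add: k_def[abs_def])
  note [measurable] = HS_measurable[OF F, simplified]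
  have rhs: "integrable lborel (\<lambda>x. (t * (norm (F (of_real x)))\<^sup>2 + (norm (k x))\<^sup>2 / t) / 2)"
    by (intro integrable_divide_zero Bochner_Integration.integrable_add integrable_mult_right HS_L2[OF F] ik)
  have pw: "norm (F (of_real x) * k x) \<le> (t * (norm (F (of_real x)))\<^sup>2 + (norm (k x))\<^sup>2 / t) / 2" for x
  proof -
    have "0 \<le> (t * norm (F (of_real x)) - norm (k x))\<^sup>2 / t" using t by simp
    then show ?thesis using t by (simp add: norm_mult power2_eq_square field_simps)
  qed
  have "n = norm (LINT x|lborel. F (of_real x) * k x)"
    unfolding k_def HS_reproducing[OF F \<Delta>] n_def ..
  also have "\<dots> \<le> (LINT x|lborel. (t * (norm (F (of_real x)))\<^sup>2 + (norm (k x))\<^sup>2 / t) / 2)"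
    by (rule Bochner_Integration.integral_norm_bound_integral[OF _ rhs pw])
       (rule Bochner_Integration.integrable_bound[OF rhs], measurable, use order_trans[OF pw abs_ge_self] in \<open>auto intro!: AE_I2\<close>)
  also have "\<dots> = (t * L + (LINT x|lborel. (norm (k x))\<^sup>2) / t) / 2"
    using HS_L2[OF F] ik by (simp add: L_def)
  also have "\<dots> \<le> (t * L + K / t) / 2"
    using integral_csinc_norm_sq_le[OF \<Delta>, of w] t by (auto simp: K_def k_def intro!: divide_right_mono)
  finally have "n \<le> (K * L / n + n) / 2" using K by (simp add: t_def)
  then have "n * n \<le> K * L" using K by (simp add: field_simps)
  then show ?thesis by (simp add: n_def K_def L_def power2_eq_square)
qed (use \<Delta> in simp)

definition HS_norm_sq :: "(complex \<Rightarrow> complex) \<Rightarrow> real" where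
  "HS_norm_sq F = (LINT x|lborel. (norm (F (of_real x)))\<^sup>2 * wSp x)"

lemma HS_norm_sq_nonneg: "0 \<le> HS_norm_sq F"
  unfolding HS_norm_sq_def by (intro integral_nonneg_AE) (auto simp: wSp_nonneg)

lemma HS_integrable_norm_sq:
  "F \<in> HS G \<Delta> \<Longrightarrow> integrable lborel (\<lambda>x::real. (norm (F (of_real x)))\<^sup>2 * wSp x)"
  by (simp add: HS_def)

text \<open>Only an interval of length proportional to the inverse of the evaluation constant
  carries a small weight, and at most half of the unweighted norm can sit there.\<close>

lemma HS_eval_le:
  assumes \<Delta>: "0 < \<Delta>"
  obtains C where "0 < C"
    "\<And>F z. F \<in> HS G \<Delta> \<Longrightarrow> (norm (F z))\<^sup>2 \<le> C * exp (2 * pi * \<Delta> * \<bar>Im z\<bar>) * HS_norm_sq F"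
proof -
  define \<delta> where "\<delta> = 1 / (4 * \<Delta>)"
  have \<delta>: "0 < \<delta>" using \<Delta> by (simp add: \<delta>_def)
  obtain c where c: "0 < c" "\<And>x. \<delta> \<le> \<bar>x\<bar> \<Longrightarrow> c \<le> wSp x"
    using wSp_bounded_below[OF \<delta>] by blast
  show ?thesis
  proof (rule that[of "\<Delta> * (2 / c)"])
    fix F and z :: complex assume F: "F \<in> HS G \<Delta>"
    define L where "L = (LINT x|lborel. (norm (F (of_real x)))\<^sup>2)"
    have L0: "0 \<le> L" unfolding L_def by (intro integral_nonneg_AE) auto
    \<comment> \<open>Inside the interval the integrand is bounded by unweighted evaluation at real
      points; outside it the lower bound \<open>c\<close> of the weight applies. The interval
      contributes \<open>L / 2\<close>, which moves to the left.\<close>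
    have "L \<le> (LINT x|lborel. \<Delta> * L * indicator {-\<delta>..\<delta>} x + (norm (F (of_real x)))\<^sup>2 * wSp x / c)"
      unfolding L_def
    proof (rule integral_mono)
      show "integrable lborel (\<lambda>x. \<Delta> * (LINT x|lborel. (norm (F (of_real x)))\<^sup>2) * indicator {-\<delta>..\<delta>} x + (norm (F (of_real x)))\<^sup>2 * wSp x / c)"
        by (intro Bochner_Integration.integrable_add integrable_mult_right integrable_divide_zero HS_integrable_norm_sq[OF F]) (use \<delta> in auto)
      fix x :: real
      show "(norm (F (of_real x)))\<^sup>2 \<le> \<Delta> * (LINT x|lborel. (norm (F (of_real x)))\<^sup>2) * indicator {-\<delta>..\<delta>} x + (norm (F (of_real x)))\<^sup>2 * wSp x / c"
      proof (cases "x \<in> {-\<delta>..\<delta>}")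
        case True
        then show ?thesis
          using HS_eval_le_L2[OF F \<Delta>, of "of_real x"] c(1) wSp_nonneg[of x]
          by (simp add: add_increasing2)
      next
        case False
        then have "c \<le> wSp x" by (intro c(2)) (auto simp: abs_if)
        then show ?thesis
          using False c(1) mult_left_mono[of c "wSp x" "(norm (F (of_real x)))\<^sup>2"] by (simp add: pos_le_divide_eq)
      qed
    qed (rule HS_L2[OF F])
    also have "\<dots> = \<Delta> * L * (2 * \<delta>) + HS_norm_sq F / c"
      using HS_integrable_norm_sq[OF F] \<delta> by (simp add: HS_norm_sq_def)
    also have "\<Delta> * L * (2 * \<delta>) = L / 2" using \<Delta> by (simp add: \<delta>_def)
    finally have L: "L \<le> 2 / c * HS_norm_sq F" by simp
    have "(norm (F z))\<^sup>2 \<le> \<Delta> * exp (2 * pi * \<Delta> * \<bar>Im z\<bar>) * L"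
      unfolding L_def by (rule HS_eval_le_L2[OF F \<Delta>])
    also have "\<dots> \<le> \<Delta> * exp (2 * pi * \<Delta> * \<bar>Im z\<bar>) * (2 / c * HS_norm_sq F)"
      using L \<Delta> by (intro mult_left_mono) auto
    finally show "(norm (F z))\<^sup>2 \<le> \<Delta> * (2 / c) * exp (2 * pi * \<Delta> * \<bar>Im z\<bar>) * HS_norm_sq F"
      by (simp add: mult_ac)
  qed (use \<Delta> c in auto)
qed

section \<open>The inner products\<close>

lemma integrable_HS_mult:
  assumes F: "F \<in> HS G \<Delta>" and H: "H \<in> HS G \<Delta>"
  shows "integrable lborel (\<lambda>x::real. F (of_real x) * cnj (H (of_real x)))"
proof (rule Bochner_Integration.integrable_bound)
  note [measurable] = HS_measurable[OF F, simplified] HS_measurable[OF H, simplified]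
  show "integrable lborel (\<lambda>x::real. (norm (F (of_real x)))\<^sup>2 + (norm (H (of_real x)))\<^sup>2)"
    by (intro Bochner_Integration.integrable_add HS_L2[OF F] HS_L2[OF H])
  have "(\<lambda>x::real. cnj (H (of_real x))) \<in> borel_measurable borel"
    by (rule borel_measurable_continuous_on[OF continuous_on_cnj[OF continuous_on_id]]) measurable
  then show "(\<lambda>x::real. F (of_real x) * cnj (H (of_real x))) \<in> borel_measurable lborel"
    by measurable
  show "AE x in lborel. norm (F (of_real x) * cnj (H (of_real x))) \<le> norm ((norm (F (of_real x)))\<^sup>2 + (norm (H (of_real x)))\<^sup>2)"
  proof (rule AE_I2)
    fix x :: real
    have "a * b \<le> a\<^sup>2 + b\<^sup>2" if "0 \<le> a" "0 \<le> b" for a b :: real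
      using zero_le_power2[of "a - b"] mult_nonneg_nonneg[OF that]
      by (simp add: power2_eq_square algebra_simps)
    from this[of "norm (F (of_real x))" "norm (H (of_real x))"]
    show "norm (F (of_real x) * cnj (H (of_real x))) \<le> norm ((norm (F (of_real x)))\<^sup>2 + (norm (H (of_real x)))\<^sup>2)"
      by (simp add: norm_mult)
  qed
qed

lemma integrable_HS_inner:
  assumes F: "F \<in> HS G \<Delta>" and H: "H \<in> HS G \<Delta>"
  shows "integrable lborel (\<lambda>x::real. F (of_real x) * cnj (H (of_real x)) * of_real (wSp x))"
proof (rule Bochner_Integration.integrable_bound)
  note i = integrable_HS_mult[OF F H]
  show "integrable lborel (\<lambda>x::real. 2 * norm (F (of_real x) * cnj (H (of_real x))))"
    using i by (intro integrable_mult_right integrable_norm)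
  show "AE x in lborel. norm (F (of_real x) * cnj (H (of_real x)) * of_real (wSp x)) \<le> norm (2 * norm (F (of_real x) * cnj (H (of_real x))))"
    using wSp_le_2 wSp_nonneg by (auto intro!: AE_I2 mult_right_mono simp: norm_mult mult.commute)
  have "(\<lambda>x. complex_of_real (wSp x)) \<in> borel_measurable lborel" by simp
  then show "(\<lambda>x::real. F (of_real x) * cnj (H (of_real x)) * of_real (wSp x)) \<in> borel_measurable lborel"
    by (intro borel_measurable_times borel_measurable_integrable[OF i])
qed

lemma cnj_HS_inner: "cnj (HS_inner G F H) = HS_inner G H F"
proof -
  have "cnj (LINT x|lborel. F (of_real x) * cnj (H (of_real x)) * of_real (wSp x)) =
      (LINT x|lborel. cnj (F (of_real x) * cnj (H (of_real x)) * of_real (wSp x)))"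
    by (rule Bochner_Integration.integral_cnj[symmetric])
  also have "\<dots> = (LINT x|lborel. H (of_real x) * cnj (F (of_real x)) * of_real (wSp x))"
    by (simp only: complex_cnj_mult complex_cnj_cnj complex_cnj_complex_of_real mult_ac)
  finally show ?thesis by (simp add: HS_inner_def)
qed

lemma HS_inner_lincomb_left:
  assumes "F \<in> HS G' \<Delta>" "F' \<in> HS G' \<Delta>" "H \<in> HS G' \<Delta>"
  shows "HS_inner G (\<lambda>z. a * F z + b * F' z) H = a * HS_inner G F H + b * HS_inner G F' H"
proof -
  have "(LINT x|lborel. (a * F (of_real x) + b * F' (of_real x)) * cnj (H (of_real x)) * of_real (wSp x)) =
    (LINT x|lborel. a * (F (of_real x) * cnj (H (of_real x)) * of_real (wSp x)) + b * (F' (of_real x) * cnj (H (of_real x)) * of_real (wSp x)))"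
    by (simp add: algebra_simps)
  also have "\<dots> = a * (LINT x|lborel. F (of_real x) * cnj (H (of_real x)) * of_real (wSp x)) + b * (LINT x|lborel. F' (of_real x) * cnj (H (of_real x)) * of_real (wSp x))"
    using integrable_HS_inner[OF assms(1,3)] integrable_HS_inner[OF assms(2,3)] by simp
  finally show ?thesis by (simp add: HS_inner_def algebra_simps)
qed

lemma HS_inner_lincomb_right:
  assumes "F \<in> HS G' \<Delta>" "F' \<in> HS G' \<Delta>" "H \<in> HS G' \<Delta>"
  shows "HS_inner G H (\<lambda>z. a * F z + b * F' z) = cnj a * HS_inner G H F + cnj b * HS_inner G H F'"
proof -
  have "HS_inner G H (\<lambda>z. a * F z + b * F' z) = cnj (HS_inner G (\<lambda>z. a * F z + b * F' z) H)"
    by (rule cnj_HS_inner[symmetric])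
  also have "\<dots> = cnj a * HS_inner G H F + cnj b * HS_inner G H F'"
    unfolding HS_inner_lincomb_left[OF assms] by (simp add: cnj_HS_inner)
  finally show ?thesis .
qed

lemma HS_inner_self: "HS_inner Sp F F = of_real (HS_norm_sq F)"
  unfolding HS_inner_def HS_norm_sq_def integral_complex_of_real[symmetric] 
  by (simp only: of_real_mult complex_norm_square) simp

text \<open>This expansion serves twice: for the parallelogram law along a minimising sequence, and
  for the variation around the minimiser.\<close>

lemma HS_norm_sq_lincomb:
  assumes F: "F \<in> HS G \<Delta>" and H: "H \<in> HS G \<Delta>"
  shows "HS_norm_sq (\<lambda>z. a * F z + b * H z) =
    (norm a)\<^sup>2 * HS_norm_sq F + 2 * Re (cnj a * b * HS_inner Sp H F) + (norm b)\<^sup>2 * HS_norm_sq H"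
proof -
  have FH: "(\<lambda>z. a * F z + b * H z) \<in> HS G \<Delta>" by (rule HS_lincomb[OF F H])
  have "complex_of_real (HS_norm_sq (\<lambda>z. a * F z + b * H z)) =
      a * (cnj a * of_real (HS_norm_sq F) + cnj b * HS_inner Sp F H)
      + b * (cnj a * HS_inner Sp H F + cnj b * of_real (HS_norm_sq H))"
    unfolding HS_inner_self[symmetric] HS_inner_lincomb_left[OF F H FH]
    HS_inner_lincomb_right[OF F H F] HS_inner_lincomb_right[OF F H H] ..
  also have "\<dots> = of_real ((norm a)\<^sup>2 * HS_norm_sq F) + of_real ((norm b)\<^sup>2 * HS_norm_sq H)
      + (cnj (cnj a * b * HS_inner Sp H F) + cnj a * b * HS_inner Sp H F)"
    unfolding of_real_mult complex_norm_square by (simp add: cnj_HS_inner algebra_simps)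
  also have "cnj (cnj a * b * HS_inner Sp H F) + cnj a * b * HS_inner Sp H F = of_real (2 * Re (cnj a * b * HS_inner Sp H F))"
    by (subst add.commute) (rule complex_add_cnj)
  finally show ?thesis
    unfolding of_real_add[symmetric] of_real_eq_iff by simp
qed

section \<open>Reproducing kernels: uniqueness and rank-one perturbation\<close>

text \<open>Each kernel is tested against the other: the product of \<open>K w\<close> and
  \<open>K' z\<close> equals \<open>K w z\<close> by the property of \<open>K'\<close>, and the
  conjugate of \<open>K' z w\<close> by that of \<open>K\<close>. Hermitian symmetry of
  \<open>K'\<close> then identifies the two.\<close>

lemma is_rk_unique:
  assumes K: "is_rk G \<Delta> K" and K': "is_rk G \<Delta> K'"
  shows "K = K'"
proof (intro ext)
  fix w z
  have "K w z = HS_inner G (K w) (K' z)" using K K' by (auto simp: is_rk_def)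
  also have "\<dots> = cnj (HS_inner G (K' z) (K w))" by (simp add: cnj_HS_inner)
  also have "HS_inner G (K' z) (K w) = K' z w" using K K' unfolding is_rk_def by metis
  also have "K' z w = HS_inner G (K' z) (K' w)" using K' by (auto simp: is_rk_def)
  also have "cnj \<dots> = HS_inner G (K' w) (K' z)" by (rule cnj_HS_inner)
  also have "\<dots> = K' w z" using K' unfolding is_rk_def by metis
  finally show "K w z = K' w z" .
qed

lemma rkernel_eq: "is_rk G \<Delta> K \<Longrightarrow> rkernel G \<Delta> = K"
  unfolding rkernel_def by (rule the_equality) (auto intro: is_rk_unique)

text \<open>The candidate is \<open>K w + c * K 0\<close>. Against it the symplectic product yields
  \<open>F w + cnj c * F 0\<close>, and the Dirac mass adds \<open>F 0\<close> times the conjugate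
  of the candidate's value at 0. The coefficient \<open>c\<close> is the one for which that value is
  \<open>- c\<close>, so the terms in \<open>F 0\<close> cancel.\<close>

lemma is_rk_SOodd:
  assumes K: "is_rk Sp \<Delta> K"
  shows "is_rk SOodd \<Delta> (\<lambda>w z. K w z - K w 0 / (1 + K 0 0) * K 0 z)"
  unfolding is_rk_def
proof (intro conjI allI ballI)
  have KH: "K w \<in> HS G \<Delta>" for w G using K HS_eq[of G \<Delta> Sp] by (simp add: is_rk_def)
  have rep: "HS_inner Sp F (K w) = F w" if "F \<in> HS G \<Delta>" for F w G
    using K that HS_eq[of G \<Delta> Sp] by (simp add: is_rk_def)
  \<comment> \<open>As a squared norm, \<open>K 0 0\<close> is real and nonnegative, so the
    denominator \<open>1 + K 0 0\<close> cannot vanish.\<close>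
  have "K 0 0 = of_real (HS_norm_sq (K 0))"
    using rep[OF KH, of 0 0] by (simp add: HS_inner_self)
  then have K00: "1 + K 0 0 = of_real (1 + HS_norm_sq (K 0))" by simp
  have nz: "1 + K 0 0 \<noteq> 0"
    unfolding K00 of_real_eq_0_iff using HS_norm_sq_nonneg[of "K 0"] by linarith
  fix w
  define c where "c = - (K w 0 / (1 + K 0 0))"
  have eq: "(\<lambda>z. K w z - K w 0 / (1 + K 0 0) * K 0 z) = (\<lambda>z. 1 * K w z + c * K 0 z)"
    by (simp add: c_def)
  show "(\<lambda>z. K w z - K w 0 / (1 + K 0 0) * K 0 z) \<in> HS SOodd \<Delta>"
    unfolding eq by (intro HS_lincomb KH)
  fix F assume F: "F \<in> HS SOodd \<Delta>"
  have cK: "K w 0 + c * K 0 0 = - c"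
    using nz by (simp add: c_def field_simps)
  have "HS_inner SOodd F (\<lambda>z. 1 * K w z + c * K 0 z) =
      HS_inner Sp F (\<lambda>z. 1 * K w z + c * K 0 z) + F 0 * cnj (K w 0 + c * K 0 0)"
    by (simp add: HS_inner_def)
  also have "HS_inner Sp F (\<lambda>z. 1 * K w z + c * K 0 z) = F w + cnj c * F 0"
    unfolding HS_inner_lincomb_right[OF KH KH F] rep[OF F] by simp
  also have "F w + cnj c * F 0 + F 0 * cnj (K w 0 + c * K 0 0) = F w"
    unfolding cK by simp
  finally show "F w = HS_inner SOodd F (\<lambda>z. K w z - K w 0 / (1 + K 0 0) * K 0 z)"
    unfolding eq by simp
qed

text \<open>For type at most one the product of two elements has type at most \<open>2 * pi\<close>, so the
  reproducing formula evaluates its integral against \<open>csinc 2\<close>.\<close>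

lemma HS_inner_Sp_le_1:
  assumes F: "F \<in> HS G \<Delta>" and H: "H \<in> HS G \<Delta>" and \<Delta>: "0 < \<Delta>" "\<Delta> \<le> 1"
  shows "HS_inner Sp F H = (LINT x|lborel. F (of_real x) * cnj (H (of_real x))) - F 0 * cnj (H 0) / 2"
proof -
  define P where "P = (\<lambda>z. F z * reflect H z)"
  have P: "P (of_real x) = F (of_real x) * cnj (H (of_real x))" for x :: real
    by (simp add: P_def reflect_def)
  have type: "exp_type_le (pi * 2) P"
    unfolding P_def using \<Delta>
    by (intro exp_type_le_mono[OF exp_type_le_mult[OF HS_exp_type[OF F] exp_type_le_reflect[OF HS_exp_type[OF H]]]])
       (simp add: mult_left_mono flip: distrib_left)
  have iP: "integrable lborel (\<lambda>x::real. P (of_real x))"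
    unfolding P by (rule integrable_HS_mult[OF F H])
  obtain M where M: "\<And>x::real. norm (P (of_real x)) \<le> M"
    using exp_type_le_integrable_bounded[OF type _ iP] by auto
  have cP: "continuous_on UNIV P"
    by (intro holomorphic_on_imp_continuous_on exp_type_le_holomorphic[OF type])
  note [measurable] = borel_measurable_of_real_compose[OF cP, simplified]
  have iP': "integrable lborel (\<lambda>x::real. norm (P (of_real x)) / (1 + \<bar>x\<bar>))"
    by (rule Bochner_Integration.integrable_bound[OF iP])
       (measurable, auto intro!: AE_I2 simp: divide_le_eq mult_le_cancel_left1)
  have rep: "(LINT x|lborel. P (of_real x) * csinc 2 (of_real x)) = P 0"
    using exp_type_le_reproducing[OF type _ M iP', of 0] by simp
  have iPc: "integrable lborel (\<lambda>x::real. P (of_real x) * csinc 2 (of_real x))"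
    using integrable_mult_csinc[OF cP iP', of 2 0] by simp
  have "HS_inner Sp F H = (LINT x|lborel. P (of_real x) - P (of_real x) * csinc 2 (of_real x) / 2)"
    unfolding HS_inner_def P[symmetric] of_real_wSp by (simp add: algebra_simps)
  also have "\<dots> = (LINT x|lborel. P (of_real x)) - P 0 / 2"
    using iP iPc by (simp add: rep)
  finally show ?thesis by (simp add: P) (simp add: P_def reflect_def)
qed

lemma is_rk_SOodd_le_1:
  assumes \<Delta>: "0 < \<Delta>" "\<Delta> \<le> 1"
  shows "is_rk SOodd \<Delta> (\<lambda>w z. csinc \<Delta> (z - cnj w) - 1 / (2 + of_real \<Delta>) * csinc \<Delta> z * csinc \<Delta> (cnj w))"
  unfolding is_rk_def
proof (intro conjI allI ballI)
  fix w
  define c where "c = - (csinc \<Delta> (cnj w) / (2 + of_real \<Delta>))"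
  define k where "k = (\<lambda>w z. csinc \<Delta> (z - cnj w))"
  have eq: "(\<lambda>z. csinc \<Delta> (z - cnj w) - 1 / (2 + of_real \<Delta>) * csinc \<Delta> z * csinc \<Delta> (cnj w))
      = (\<lambda>z. 1 * k w z + c * k 0 z)"
    by (simp add: c_def k_def mult.commute)
  have k: "k w \<in> HS G \<Delta>" for w G
    unfolding k_def by (rule csinc_shift_in_HS[OF \<Delta>(1)])
  show "(\<lambda>z. csinc \<Delta> (z - cnj w) - 1 / (2 + of_real \<Delta>) * csinc \<Delta> z * csinc \<Delta> (cnj w)) \<in> HS SOodd \<Delta>"
    unfolding eq by (intro HS_lincomb k)
  fix F assume F: "F \<in> HS SOodd \<Delta>"
  have inner: "HS_inner Sp F (k v) = F v - F 0 * cnj (k v 0) / 2" for v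
  proof -
    have "HS_inner Sp F (k v) = (LINT x|lborel. F (of_real x) * cnj (k v (of_real x))) - F 0 * cnj (k v 0) / 2"
      by (rule HS_inner_Sp_le_1[OF F k \<Delta>])
    also have "(LINT x|lborel. F (of_real x) * cnj (k v (of_real x))) = F v"
      using HS_reproducing[OF F \<Delta>(1), of v] by (simp add: k_def cnj_csinc)
    finally show ?thesis .
  qed
  have nz: "2 + complex_of_real \<Delta> \<noteq> 0"
    using \<Delta> by (metis add_pos_pos less_irrefl of_real_0 of_real_add of_real_eq_iff of_real_numeral zero_less_numeral)
  \<comment> \<open>The left side is the value of the candidate at 0. Its conjugate meets
    \<open>F 0\<close> with the net mass 1/2, that is 1 from the Dirac mass minus 1/2 from the
    weight, so the value \<open>- 2 * c\<close> is what cancels the term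
    \<open>cnj c * F 0\<close>.\<close>
  have c: "k w 0 + c * of_real \<Delta> = - 2 * c"
    using nz by (simp add: c_def k_def field_simps)
  have "HS_inner SOodd F (\<lambda>z. 1 * k w z + c * k 0 z) =
      HS_inner Sp F (\<lambda>z. 1 * k w z + c * k 0 z) + F 0 * cnj (k w 0 + c * k 0 0)"
    by (simp add: HS_inner_def)
  also have "HS_inner Sp F (\<lambda>z. 1 * k w z + c * k 0 z) =
      F w + cnj c * F 0 - F 0 * cnj (k w 0 + c * k 0 0) / 2"
    unfolding HS_inner_lincomb_right[OF k k F] inner by (simp add: algebra_simps add_divide_distrib)
  also have "F w + cnj c * F 0 - F 0 * cnj (k w 0 + c * k 0 0) / 2 + F 0 * cnj (k w 0 + c * k 0 0)
      = F w + cnj c * F 0 + F 0 * cnj (k w 0 + c * of_real \<Delta>) / 2"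
    by (simp add: k_def)
  also have "\<dots> = F w" unfolding c by simp
  finally show "F w = HS_inner SOodd F (\<lambda>z. csinc \<Delta> (z - cnj w) - 1 / (2 + of_real \<Delta>) * csinc \<Delta> z * csinc \<Delta> (cnj w))"
    unfolding eq by simp
qed

section \<open>Existence of the symplectic kernel\<close>

text \<open>The zeros of the sine are real, while \<open>w - cnj w\<close> is purely imaginary.
  Hence the Paley-Wiener kernel at \<open>w\<close> does not vanish at \<open>w\<close>, and the
  space contains an element with value 1 there.\<close>

lemma csinc_diff_cnj_nonzero:
  assumes "0 < \<Delta>" shows "csinc \<Delta> (w - cnj w) \<noteq> 0"
proof
  assume "csinc \<Delta> (w - cnj w) = 0"
  then have "w - cnj w \<noteq> 0" "sin (of_real (pi * \<Delta>) * (w - cnj w)) = 0"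
    using assms by (auto simp: csinc_def split: if_splits)
  then obtain n :: int where n: "of_real (pi * \<Delta>) * (w - cnj w) = of_real (n * pi)" and nz: "Im w \<noteq> 0"
    by (auto simp: sin_eq_0 complex_diff_cnj)
  have "Im (of_real (pi * \<Delta>) * (w - cnj w)) = 0" unfolding n by (rule Im_complex_of_real)
  then show False using nz assms by simp
qed

text \<open>Minimising the norm among the elements with value 1 at \<open>w\<close>: by the parallelogram law a
  minimising sequence is Cauchy, evaluation bounds turn this into locally uniform convergence,
  and Fatou's lemma shows that the limit is a minimiser.\<close>

lemma HS_minimizer:
  assumes \<Delta>: "0 < \<Delta>"
  obtains E where "E \<in> HS Sp \<Delta>" "E w = 1"
    "\<And>F. F \<in> HS Sp \<Delta> \<Longrightarrow> F w = 1 \<Longrightarrow> HS_norm_sq E \<le> HS_norm_sq F"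
proof -
  obtain C where C: "0 < C"
    "\<And>F z. F \<in> HS Sp \<Delta> \<Longrightarrow> (norm (F z))\<^sup>2 \<le> C * exp (2 * pi * \<Delta> * \<bar>Im z\<bar>) * HS_norm_sq F"
    using HS_eval_le[OF \<Delta>] by blast
  define A where "A = {F \<in> HS Sp \<Delta>. F w = 1}"
  define d where "d = Inf (HS_norm_sq ` A)"
  have bdd: "bdd_below (HS_norm_sq ` A)"
    by (rule bdd_belowI[of _ 0]) (auto simp: HS_norm_sq_nonneg)
  have "(\<lambda>z. inverse (csinc \<Delta> (w - cnj w)) * csinc \<Delta> (z - cnj w) + 0 * csinc \<Delta> (z - cnj w)) \<in> A"
    unfolding A_def using csinc_diff_cnj_nonzero[OF \<Delta>, of w]
    by (auto intro!: HS_lincomb[of "\<lambda>z. csinc \<Delta> (z - cnj w)" _ _ "\<lambda>z. csinc \<Delta> (z - cnj w)" _ 0, simplified] csinc_shift_in_HS[OF \<Delta>])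
  then have ne: "HS_norm_sq ` A \<noteq> {}" by blast
  have dle: "d \<le> HS_norm_sq F" if "F \<in> A" for F
    unfolding d_def using bdd that by (intro cInf_lower) auto
  have "\<exists>F\<in>A. HS_norm_sq F < d + 1 / real (Suc n)" for n
    using cInf_lessD[OF ne, of "d + 1 / real (Suc n)"] by (auto simp: d_def)
  then obtain f where fA: "\<And>n. f n \<in> A" and fd: "\<And>n. HS_norm_sq (f n) < d + 1 / real (Suc n)"
    by metis
  have fH: "f n \<in> HS Sp \<Delta>" and fw: "f n w = 1" for n using fA[of n] by (auto simp: A_def)
  have diff: "(norm (f n z - f m z))\<^sup>2 \<le> C * exp (2 * pi * \<Delta> * \<bar>Im z\<bar>) * (2 / real (Suc n) + 2 / real (Suc m))" for n m z
  proof -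
    \<comment> \<open>The constraint of value 1 at \<open>w\<close> is convex, so the midpoint has
      squared norm at least \<open>d\<close>. This is the lower bound that forces the difference of
      two late terms to be small.\<close>
    have "(\<lambda>z. (1/2) * f n z + (1/2) * f m z) \<in> A"
      unfolding A_def using HS_lincomb[OF fH[of n] fH[of m], of "1/2" "1/2"] by (simp add: fw)
    from dle[OF this] have mid: "4 * d \<le> HS_norm_sq (f n) + 2 * Re (HS_inner Sp (f m) (f n)) + HS_norm_sq (f m)"
      unfolding HS_norm_sq_lincomb[OF fH fH] by (simp add: power2_eq_square)
    have dif: "HS_norm_sq (\<lambda>z. 1 * f n z + (-1) * f m z) = HS_norm_sq (f n) - 2 * Re (HS_inner Sp (f m) (f n)) + HS_norm_sq (f m)"
      unfolding HS_norm_sq_lincomb[OF fH fH] by simp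
    have N: "HS_norm_sq (\<lambda>z. 1 * f n z + (-1) * f m z) \<le> 2 / real (Suc n) + 2 / real (Suc m)"
    proof -
      have "2 / real (Suc n) = 2 * (1 / real (Suc n))" "2 / real (Suc m) = 2 * (1 / real (Suc m))" by simp_all
      then show ?thesis using mid dif fd[of n] fd[of m] by linarith
    qed
    have "(norm (f n z - f m z))\<^sup>2 \<le> C * exp (2 * pi * \<Delta> * \<bar>Im z\<bar>) * HS_norm_sq (\<lambda>z. 1 * f n z + (-1) * f m z)"
      using C(2)[OF HS_lincomb[OF fH[of n] fH[of m], of 1 "-1"], of z] by simp
    also have "\<dots> \<le> C * exp (2 * pi * \<Delta> * \<bar>Im z\<bar>) * (2 / real (Suc n) + 2 / real (Suc m))"
      using N C(1) by (intro mult_left_mono) auto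
    finally show ?thesis .
  qed
  have Cau: "uniformly_Cauchy_on (cball z0 1) f" for z0
  proof (rule uniformly_Cauchy_onI)
    fix e :: real assume e: "0 < e"
    define B where "B = C * exp (2 * pi * \<Delta> * (norm z0 + 1))"
    have B: "0 < B" using C by (simp add: B_def)
    have "(\<lambda>n. B * (4 / real (Suc n))) \<longlonglongrightarrow> 0" by real_asymp
    then have "\<forall>\<^sub>F n in sequentially. B * (4 / real (Suc n)) < e\<^sup>2"
      using e by (simp add: order_tendsto_iff)
    then obtain M where M: "B * (4 / real (Suc M)) < e\<^sup>2" by (auto simp: eventually_sequentially)
    show "\<exists>M. \<forall>z\<in>cball z0 1. \<forall>m\<ge>M. \<forall>n\<ge>M. dist (f m z) (f n z) < e"
    proof (intro exI[of _ M] ballI allI impI)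
      fix z m n assume z: "z \<in> cball z0 1" and mn: "M \<le> m" "M \<le> n"
      have "\<bar>Im z\<bar> \<le> norm z0 + 1"
        using z abs_Im_le_cmod[of z] norm_triangle_ineq2[of z z0] by (auto simp: dist_norm norm_minus_commute)
      then have "C * exp (2 * pi * \<Delta> * \<bar>Im z\<bar>) \<le> B" using C \<Delta> by (simp add: B_def)
      moreover have "2 / real (Suc m) + 2 / real (Suc n) \<le> 2 / real (Suc M) + 2 / real (Suc M)"
        using mn by (intro add_mono divide_left_mono) auto
      ultimately have "C * exp (2 * pi * \<Delta> * \<bar>Im z\<bar>) * (2 / real (Suc m) + 2 / real (Suc n)) \<le> B * (2 / real (Suc M) + 2 / real (Suc M))"
        using B by (intro mult_mono) auto
      moreover have "2 / real (Suc M) + 2 / real (Suc M) = 4 / real (Suc M)"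
        by (simp flip: add_divide_distrib)
      ultimately have "(norm (f m z - f n z))\<^sup>2 < e\<^sup>2"
        using diff[of m z n] M by (metis order_le_less_trans order_trans)
      then show "dist (f m z) (f n z) < e" using e by (simp add: dist_norm power_less_imp_less_base)
    qed
  qed
  define E where "E = (\<lambda>z. lim (\<lambda>n. f n z))"
  have ulim: "uniform_limit (cball z0 1) f E sequentially" for z0
    using Cauchy_uniformly_convergent[OF Cau[of z0]]
    unfolding E_def by (simp add: uniformly_convergent_uniform_limit_iff)
  have lim: "(\<lambda>n. f n z) \<longlonglongrightarrow> E z" for z
    by (rule tendsto_uniform_limitI[OF ulim[of z]]) auto
  have holE: "E holomorphic_on UNIV"
  proof (rule holomorphic_uniform_sequence[of UNIV f])
    show "f n holomorphic_on UNIV" for n by (rule exp_type_le_holomorphic[OF HS_exp_type[OF fH]])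
    show "\<exists>r>0. cball z r \<subseteq> UNIV \<and> uniform_limit (cball z r) f E sequentially" for z
      using ulim[of z] by (intro exI[of _ 1]) auto
  qed auto
  have fd1: "HS_norm_sq (f n) \<le> d + 1" for n
    using fd[of n] by (rule order_trans[OF less_imp_le]) (simp add: field_simps)
  \<comment> \<open>The evaluation bound survives the pointwise limit. Its rate
    \<open>2 * pi * \<Delta>\<close> for the squared modulus is exactly what gives the limit type at
    most \<open>pi * \<Delta>\<close>.\<close>
  have bE: "(norm (E z))\<^sup>2 \<le> C * exp (2 * pi * \<Delta> * \<bar>Im z\<bar>) * (d + 1)" for z
  proof (rule LIMSEQ_le_const2)
    show "(\<lambda>n. (norm (f n z))\<^sup>2) \<longlonglongrightarrow> (norm (E z))\<^sup>2" by (intro tendsto_intros lim)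
    show "\<exists>N. \<forall>n\<ge>N. (norm (f n z))\<^sup>2 \<le> C * exp (2 * pi * \<Delta> * \<bar>Im z\<bar>) * (d + 1)"
      using C fd1 by (intro exI[of _ 0] allI impI order_trans[OF C(2)[OF fH]] mult_left_mono) auto
  qed
  have d0: "0 \<le> d" unfolding d_def by (rule cInf_greatest[OF ne]) (auto simp: HS_norm_sq_nonneg)
  have typeE: "exp_type_le (pi * \<Delta>) E"
  proof (rule exp_type_leI[OF holE])
    fix \<sigma> assume \<sigma>: "pi * \<Delta> < \<sigma>"
    define D where "D = sqrt (C * (d + 1))"
    have D: "0 \<le> D" "D\<^sup>2 = C * (d + 1)" using C d0 by (auto simp: D_def)
    have "norm (E z) \<le> D * exp (\<sigma> * norm z)" for z
    proof (rule power2_le_imp_le)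
      have e: "exp (2 * pi * \<Delta> * \<bar>Im z\<bar>) = (exp (pi * \<Delta> * \<bar>Im z\<bar>))\<^sup>2"
        by (simp add: power2_eq_square flip: exp_add)
      have "pi * \<Delta> * \<bar>Im z\<bar> \<le> \<sigma> * norm z"
        using \<sigma> \<Delta> abs_Im_le_cmod[of z] by (intro mult_mono) (auto intro: order_trans[of 0 "pi * \<Delta>"])
      then have "C * (d + 1) * (exp (pi * \<Delta> * \<bar>Im z\<bar>))\<^sup>2 \<le> C * (d + 1) * (exp (\<sigma> * norm z))\<^sup>2"
        using C d0 by (intro mult_left_mono power_mono) auto
      then show "(norm (E z))\<^sup>2 \<le> (D * exp (\<sigma> * norm z))\<^sup>2"
        using bE[of z] unfolding e power_mult_distrib D(2) by (simp add: mult_ac)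
    qed (use D in auto)
    then show "\<exists>C. \<forall>z. norm (E z) \<le> C * exp (\<sigma> * norm z)" by blast
  qed
  define u where "u = (\<lambda>(F::complex \<Rightarrow> complex) (x::real). (norm (F (complex_of_real x)))\<^sup>2 * wSp x)"
  have mu: "u F \<in> borel_measurable borel" if "continuous_on UNIV F" for F
    using borel_measurable_of_real_compose[OF that] unfolding u_def by (simp, measurable)
  have u0: "0 \<le> u F x" for F x by (simp add: u_def wSp_nonneg)
  have muE: "u E \<in> borel_measurable lborel" using mu[OF holomorphic_on_imp_continuous_on[OF holE]] by simp
  have muf: "u (f n) \<in> borel_measurable lborel" for n using mu[OF HS_continuous[OF fH]] by simp
  have Iu: "(\<integral>\<^sup>+ x. ennreal (u (f n) x) \<partial>lborel) = ennreal (HS_norm_sq (f n))" for n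
    unfolding HS_norm_sq_def u_def
    using HS_integrable_norm_sq[OF fH[of n]] by (intro nn_integral_eq_integral) (auto simp: wSp_nonneg)
  have nn: "(\<integral>\<^sup>+ x. ennreal (u E x) \<partial>lborel) \<le> ennreal d"
  proof -
    have ul: "(\<lambda>n. ennreal (u (f n) x)) \<longlonglongrightarrow> ennreal (u E x)" for x
      unfolding u_def by (intro tendsto_ennrealI tendsto_intros lim)
    have "(\<integral>\<^sup>+ x. ennreal (u E x) \<partial>lborel) = (\<integral>\<^sup>+ x. liminf (\<lambda>n. ennreal (u (f n) x)) \<partial>lborel)"
      using lim_imp_Liminf[OF _ ul] by simp
    also have "\<dots> \<le> liminf (\<lambda>n. \<integral>\<^sup>+ x. ennreal (u (f n) x) \<partial>lborel)"
      by (intro nn_integral_liminf measurable_compose[OF muf measurable_ennreal])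
    also have "\<dots> \<le> liminf (\<lambda>n. ennreal (d + 1 / real (Suc n)))"
      unfolding Iu using fd by (intro Liminf_mono always_eventually allI ennreal_leI less_imp_le)
    also have "\<dots> = ennreal d"
    proof (rule lim_imp_Liminf)
      have "(\<lambda>n. d + 1 / real (Suc n)) \<longlonglongrightarrow> d"
        using tendsto_add[OF tendsto_const[of d] LIMSEQ_Suc[OF lim_1_over_n]] by simp
      then show "(\<lambda>n. ennreal (d + 1 / real (Suc n))) \<longlonglongrightarrow> ennreal d" by (rule tendsto_ennrealI)
    qed simp
    finally show ?thesis .
  qed
  have intE: "integrable lborel (u E)"
    using nn muE u0 by (intro integrableI_nonneg) (auto intro: order_le_less_trans)
  have EH: "E \<in> HS Sp \<Delta>" using typeE intE by (simp add: HS_def u_def)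
  have "ennreal (HS_norm_sq E) \<le> ennreal d"
    using nn nn_integral_eq_integral[OF intE] u0 by (simp add: HS_norm_sq_def u_def)
  then have "HS_norm_sq E \<le> d" using d0 by simp
  moreover have "E w = 1" using lim[of w] by (simp add: fw LIMSEQ_const_iff)
  ultimately show ?thesis
    using that[of E] EH dle by (fastforce simp: A_def)
qed

text \<open>Riesz representation for evaluation at \<open>w\<close>: the minimiser \<open>E\<close>
  is orthogonal to every element vanishing at \<open>w\<close>, in particular to
  \<open>F - F w * E\<close>. Therefore the product of \<open>F\<close> with \<open>E\<close> is
  \<open>F w\<close> times the squared norm of \<open>E\<close>, and dividing \<open>E\<close> by
  that number gives the kernel function.\<close>

lemma ex_is_rk_Sp:
  assumes \<Delta>: "0 < \<Delta>"
  shows "\<exists>K. is_rk Sp \<Delta> K"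
proof -
  have "\<exists>k\<in>HS Sp \<Delta>. \<forall>F\<in>HS Sp \<Delta>. F w = HS_inner Sp F k" for w
  proof -
    obtain E where E: "E \<in> HS Sp \<Delta>" "E w = 1"
      "\<And>F. F \<in> HS Sp \<Delta> \<Longrightarrow> F w = 1 \<Longrightarrow> HS_norm_sq E \<le> HS_norm_sq F"
      using HS_minimizer[OF \<Delta>] by blast
    define d where "d = HS_norm_sq E"
    obtain C where C: "0 < C"
      "\<And>F z. F \<in> HS Sp \<Delta> \<Longrightarrow> (norm (F z))\<^sup>2 \<le> C * exp (2 * pi * \<Delta> * \<bar>Im z\<bar>) * HS_norm_sq F"
      using HS_eval_le[OF \<Delta>] by blast
    \<comment> \<open>An element of norm zero would vanish at \<open>w\<close> by the evaluation
      bound, whereas \<open>E w = 1\<close>.\<close>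
    have "d \<noteq> 0" using C(2)[OF E(1), of w] E(2) by (auto simp: d_def)
    have orth: "HS_inner Sp H E = 0" if H: "H \<in> HS Sp \<Delta>" "H w = 0" for H
    proof (rule ccontr)
      define a where "a = HS_inner Sp H E"
      assume "HS_inner Sp H E \<noteq> 0"
      then have a: "0 < (norm a)\<^sup>2" by (simp add: a_def)
      define N where "N = HS_norm_sq H"
      have N: "0 \<le> N" by (simp add: N_def HS_norm_sq_nonneg)
      \<comment> \<open>The optimal step would be \<open>1 / N\<close>; \<open>N + 1\<close> avoids
        division by zero, and \<open>s * N \<le> 1\<close> is enough for the linear gain
        \<open>2 * s * (norm a)\<^sup>2\<close> to outweigh the quadratic loss.\<close>
      define s where "s = 1 / (N + 1)"
      have s: "0 < s" "s * N \<le> 1" using N by (auto simp: s_def field_simps)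
      define t where "t = - (of_real s * cnj a)"
      have "d \<le> HS_norm_sq (\<lambda>z. 1 * E z + t * H z)"
        unfolding d_def by (intro E(3) HS_lincomb E(1) H(1)) (simp add: E(2) H(2))
      also have "\<dots> = d + 2 * Re (t * a) + (norm t)\<^sup>2 * N"
        unfolding HS_norm_sq_lincomb[OF E(1) H(1)] by (simp add: d_def a_def N_def)
      also have "t * a = of_real (- (s * (norm a)\<^sup>2))"
        unfolding t_def of_real_minus of_real_mult complex_norm_square by simp
      also have "(norm t)\<^sup>2 = s\<^sup>2 * (norm a)\<^sup>2" using s by (simp add: t_def norm_mult power_mult_distrib)
      finally have "2 * s * (norm a)\<^sup>2 \<le> (s * N) * (s * (norm a)\<^sup>2)" by (simp add: power2_eq_square mult_ac)
      also have "\<dots> \<le> 1 * (s * (norm a)\<^sup>2)" using s by (intro mult_right_mono) auto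
      finally show False using a s by simp
    qed
    define k where "k = (\<lambda>z. of_real (1 / d) * E z + 0 * E z)"
    have "k \<in> HS Sp \<Delta>" unfolding k_def by (intro HS_lincomb E(1))
    moreover have "F w = HS_inner Sp F k" if F: "F \<in> HS Sp \<Delta>" for F
    proof -
      have "HS_inner Sp (\<lambda>z. 1 * F z + (- F w) * E z) E = 0"
        by (intro orth HS_lincomb F E(1)) (simp add: E(2))
      then have "HS_inner Sp F E = F w * of_real d"
        unfolding HS_inner_lincomb_left[OF F E(1) E(1)] by (simp add: HS_inner_self d_def)
      then show ?thesis
        unfolding k_def HS_inner_lincomb_right[OF E(1) E(1) F] using \<open>d \<noteq> 0\<close> by simp
    qed
    ultimately show ?thesis by blast
  qed
  then obtain K where "\<And>w. K w \<in> HS Sp \<Delta>" "\<And>w F. F \<in> HS Sp \<Delta> \<Longrightarrow> F w = HS_inner Sp F (K w)"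
    by metis
  then show ?thesis by (auto simp: is_rk_def)
qed

theorem theorem7:
  shows "(\<forall>\<Delta>::real. 0 < \<Delta> \<and> \<Delta> \<le> 1 \<longrightarrow> (\<forall>w z.
            rkernel SOodd \<Delta> w z =
              csinc \<Delta> (z - cnj w) - 1 / (2 + of_real \<Delta>) * csinc \<Delta> z * csinc \<Delta> (cnj w)))
       \<and> (\<forall>\<Delta>::real. 0 < \<Delta> \<longrightarrow> (\<forall>w z.
            rkernel SOodd \<Delta> w z =
              rkernel Sp \<Delta> w z
              - rkernel Sp \<Delta> w 0 / (1 + rkernel Sp \<Delta> 0 0) * rkernel Sp \<Delta> 0 z))"
proof (intro conjI allI impI)
  fix \<Delta> :: real and w z assume "0 < \<Delta> \<and> \<Delta> \<le> 1"
  then show "rkernel SOodd \<Delta> w z =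
      csinc \<Delta> (z - cnj w) - 1 / (2 + of_real \<Delta>) * csinc \<Delta> z * csinc \<Delta> (cnj w)"
    using rkernel_eq[OF is_rk_SOodd_le_1] by simp
next
  fix \<Delta> :: real and w z assume "0 < \<Delta>"
  then obtain K where K: "is_rk Sp \<Delta> K" using ex_is_rk_Sp by blast
  show "rkernel SOodd \<Delta> w z = rkernel Sp \<Delta> w z
      - rkernel Sp \<Delta> w 0 / (1 + rkernel Sp \<Delta> 0 0) * rkernel Sp \<Delta> 0 z"
    unfolding rkernel_eq[OF K] rkernel_eq[OF is_rk_SOodd[OF K]] ..
qed

end
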